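(* On the flat $3$-torus $\mathbb{T}^3=\mathbb{R}^3/\mathbb{Z}^3$ there exists an orthonormal basis of $L^2(\mathbb{T}^3)$ consisting of real-valued eigenfunctions of the Laplacian such that every nonconstant eigenfunction in the basis has exactly two nodal domains.
   Context: Nodal domains of a real-valued eigenfunction are the connected components of the complement of its zero set. *)

theory Defs
  imports "HOL-Analysis.Analysis"
begin

definition int_equiv :: "real ^ 3 \<Rightarrow> real ^ 3 \<Rightarrow> bool" where
  "int_equiv x y \<longleftrightarrow> (\<forall>i. x $ i - y $ i \<in> \<int>)"

quotient_type torus3 = "real ^ 3" / int_equiv
  morphisms rep_torus3 torus3_proj
proof (rule equivpI)
  show "reflp int_equiv"
    by (simp add: reflp_def int_equiv_def)
  show "symp int_equiv"
    unfolding symp_def int_equiv_def by (metis Ints_minus minus_diff_eq)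
  show "transp int_equiv"
    unfolding transp_def int_equiv_def by (metis Ints_add diff_add_cancel add_diff_eq)
qed

instantiation torus3 :: topological_space
begin

definition open_torus3 :: "torus3 set \<Rightarrow> bool" where
  "open_torus3 U \<longleftrightarrow> open (torus3_proj -` U)"

instance
  by standard (auto simp: open_torus3_def vimage_Union)

end

lemma continuous_on_torus3_proj: "continuous_on A torus3_proj"
  by (rule continuous_on_subset[of UNIV])
     (simp_all add: continuous_on_open_vimage open_torus3_def)

text \<open>The Riemannian measure: every point of the torus has exactly one representative in the
  half-open unit cube, so it is the image of Lebesgue measure on that cube.\<close>

definition unit_cube :: "(real ^ 3) set" where
  "unit_cube = {x. \<forall>i. 0 \<le> x $ i \<and> x $ i < 1}"

definition torus3_measure :: "torus3 measure" where
  "torus3_measure = distr (restrict_space lborel unit_cube) borel torus3_proj"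

lemma torus3_proj_measurable: "torus3_proj \<in> measurable (restrict_space lborel unit_cube) borel"
proof -
  have "torus3_proj \<in> borel_measurable borel"
    by (intro borel_measurable_continuous_onI continuous_on_torus3_proj)
  then show ?thesis
    by (simp add: measurable_restrict_space1)
qed

text \<open>Square-integrable functions are not identified when they agree almost everywhere.\<close>

definition L2_torus3 :: "(torus3 \<Rightarrow> complex) set" where
  "L2_torus3 = {f \<in> borel_measurable torus3_measure.
     integrable torus3_measure (\<lambda>p. (cmod (f p))\<^sup>2)}"

definition L2_inner :: "(torus3 \<Rightarrow> complex) \<Rightarrow> (torus3 \<Rightarrow> complex) \<Rightarrow> complex" where
  "L2_inner f g = (LINT p|torus3_measure. f p * cnj (g p))"

definition L2_dist :: "(torus3 \<Rightarrow> complex) \<Rightarrow> (torus3 \<Rightarrow> complex) \<Rightarrow> real" where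
  "L2_dist f g = sqrt (LINT p|torus3_measure. (cmod (f p - g p))\<^sup>2)"

definition orthonormal_basis_L2 :: "(torus3 \<Rightarrow> complex) set \<Rightarrow> bool" where
  "orthonormal_basis_L2 B \<longleftrightarrow>
     B \<subseteq> L2_torus3 \<and>
     (\<forall>f\<in>B. \<forall>g\<in>B. L2_inner f g = (if f = g then 1 else 0)) \<and>
     (\<forall>f\<in>L2_torus3. \<forall>\<epsilon>>0. \<exists>F c. finite F \<and> F \<subseteq> B \<and>
        L2_dist f (\<lambda>p. \<Sum>b\<in>F. c b * b p) < \<epsilon>)"

definition partial_deriv ::
  "'n::finite \<Rightarrow> (real ^ 'n \<Rightarrow> 'a::real_normed_vector) \<Rightarrow> real ^ 'n \<Rightarrow> 'a" where
  "partial_deriv i g x = vector_derivative (\<lambda>t. g (x + t *\<^sub>R axis i 1)) (at 0)"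

text \<open>A function is $C^{k+1}$ iff it is differentiable with $C^k$ partial derivatives.\<close>

fun C_k :: "nat \<Rightarrow> (real ^ 'n::finite \<Rightarrow> 'a::real_normed_vector) \<Rightarrow> bool" where
  "C_k 0 g \<longleftrightarrow> continuous_on UNIV g"
| "C_k (Suc k) g \<longleftrightarrow> (\<forall>x. g differentiable (at x)) \<and> (\<forall>i. C_k k (partial_deriv i g))"

definition laplacian :: "(real ^ 'n::finite \<Rightarrow> 'a::real_normed_vector) \<Rightarrow> real ^ 'n \<Rightarrow> 'a" where
  "laplacian g x = (\<Sum>i\<in>UNIV. partial_deriv i (partial_deriv i g) x)"

text \<open>The projection is a local isometry for the flat metric, so smoothness and the Laplacian
  of \<open>f\<close> are those of its periodic lift. Eigenfunctions are taken to be smooth, which is no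
  restriction by elliptic regularity.\<close>

definition laplace_eigenfunction :: "(torus3 \<Rightarrow> complex) \<Rightarrow> bool" where
  "laplace_eigenfunction f \<longleftrightarrow>
     (\<exists>p. f p \<noteq> 0) \<and>
     (\<forall>k. C_k k (f \<circ> torus3_proj)) \<and>
     (\<exists>\<mu>::complex. \<forall>x. laplacian (f \<circ> torus3_proj) x = \<mu> * f (torus3_proj x))"

definition nodal_domains :: "('a::topological_space \<Rightarrow> 'b::zero) \<Rightarrow> 'a set set" where
  "nodal_domains f = components {x. f x \<noteq> 0}"

end

theory Submission
  imports Defs
begin

text \<open>Each eigenspace of the Laplacian is spanned by the functions \<open>cos (2 \<pi> k \<cdot> x)\<close> and
  \<open>sin (2 \<pi> k \<cdot> x)\<close> with \<open>k\<close> in \<open>\<int>\<^sup>3\<close> of a fixed length. These functions themselves have too many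
  nodal domains as soon as \<open>k\<close> is a proper multiple of another integer vector: their nodal domains are
  then several parallel slabs. The remedy is to mix three frequencies at a time.

  Suppose \<open>k\<^sub>1, k\<^sub>2, k\<^sub>3\<close> are linearly independent and \<open>a\<^sub>1, a\<^sub>2, a\<^sub>3\<close> are amplitudes whose absolute
  values satisfy the strict triangle inequalities. In the coordinates \<open>u\<^sub>m = 2 \<pi> k\<^sub>m \<cdot> x + \<phi>\<close> on \<open>\<real>\<^sup>3\<close>
  the sum of the \<open>a\<^sub>m cos (2 \<pi> k\<^sub>m \<cdot> x + \<phi>)\<close> becomes the sum of the \<open>a\<^sub>m cos u\<^sub>m\<close>. Its positivity set
  is connected: from any point one climbs to a common maximum of the three summands by moving each
  coordinate to its nearest maximum, and common maxima are joined to each other along coordinate lines,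
  on which the two resting summands outweigh the moving one
  (\<open>connected_positive_cosine_sum\<close>). The same holds for the negative of the function, and connectedness
  passes to the image in the torus, so there are exactly two nodal domains.

  It remains to choose an orthonormal basis out of such sums. Up to sign, the nonzero frequencies are
  partitioned into blocks of three or four vectors of equal length, any three of which are independent
  (\<open>freq_blocks_disjoint\<close>, \<open>freq_blocks_cover\<close>). In each block an orthogonal matrix is applied to the
  cosines and to the sines. Its rows have exactly three nonzero entries, in the proportions \<open>1 : 2 : 2\<close>
  for three vectors and \<open>1 : 1 : 1\<close> for four vectors up to sign
  (\<open>mixing_rows\<close>, \<open>block_row_three_frequencies\<close>).

  Orthonormality reduces to the mean values of plane waves. For completeness, the linear span of the basis
  contains all trigonometric polynomials. By the Stone-Weierstrass theorem these are uniformly dense in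
  the continuous functions, and dominated pointwise limits lead from there to indicators of open sets,
  indicators of Borel sets, and all of \<open>L\<^sup>2\<close> (\<open>closure_eq_L2\<close>).\<close>

section \<open>Plane waves on the torus\<close>

definition angle :: "int ^ 3 \<Rightarrow> real ^ 3 \<Rightarrow> real" where
  "angle k x = 2 * pi * (\<Sum>i\<in>UNIV. real_of_int (k $ i) * x $ i)"

text \<open>The value is independent of the representative since the frequency is integral; see
  \<open>plane_wave_proj\<close>.\<close>

definition plane_wave :: "int ^ 3 \<Rightarrow> real \<Rightarrow> torus3 \<Rightarrow> real" where
  "plane_wave k \<phi> p = cos (angle k (rep_torus3 p) + \<phi>)"

lemma angle_add: "angle (k + l) x = angle k x + angle l x"
  and angle_diff: "angle (k - l) x = angle k x - angle l x"
  and angle_uminus: "angle (- k) x = - angle k x"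
  and angle_zero: "angle 0 x = 0"
  by (simp_all add: angle_def algebra_simps sum.distrib sum_subtractf sum_negf)

lemma continuous_on_angle [continuous_intros]: "continuous_on A (angle k)"
  unfolding angle_def by (intro continuous_intros)

lemma int_equiv_rep_proj: "int_equiv (rep_torus3 (torus3_proj x)) x"
  by (rule Quotient3_rep_abs[OF Quotient3_torus3]) (simp add: int_equiv_def)

lemma proj_rep [simp]: "torus3_proj (rep_torus3 p) = p"
  by (rule Quotient3_abs_rep[OF Quotient3_torus3])

lemma surj_torus3_proj: "surj torus3_proj"
  by (metis proj_rep surjI)

lemma torus3_proj_eq_iff: "torus3_proj x = torus3_proj y \<longleftrightarrow> int_equiv x y"
  by (rule torus3.abs_eq_iff)

lemma plane_wave_proj [simp]: "plane_wave k \<phi> (torus3_proj x) = cos (angle k x + \<phi>)"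
proof -
  let ?y = "rep_torus3 (torus3_proj x)"
  have "(\<Sum>i\<in>UNIV. real_of_int (k $ i) * (?y $ i - x $ i)) \<in> \<int>"
    using int_equiv_rep_proj[of x] unfolding int_equiv_def
    by (intro Ints_sum Ints_mult) auto
  then obtain n :: int where n: "(\<Sum>i\<in>UNIV. real_of_int (k $ i) * (?y $ i - x $ i)) = of_int n"
    by (auto elim: Ints_cases)
  have "angle k ?y - angle k x = 2 * pi * of_int n"
    unfolding angle_def n[symmetric] by (simp add: sum_subtractf algebra_simps)
  then have "angle k ?y + \<phi> = (angle k x + \<phi>) + 2 * pi * of_int n" by simp
  then show ?thesis
    unfolding plane_wave_def by (simp only: cos_add[of _ "2 * pi * of_int n"] cos_int_2pin sin_int_2pin)
qed

text \<open>The torus carries the quotient topology, so continuity can be tested on the periodic lift.\<close>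

lemma continuous_on_torus3:
  fixes f :: "torus3 \<Rightarrow> 'a::topological_space"
  assumes "continuous_on UNIV (f \<circ> torus3_proj)"
  shows "continuous_on UNIV f"
  using assms by (simp add: continuous_on_open_vimage open_torus3_def vimage_comp o_def)

lemma continuous_plane_wave: "continuous_on UNIV (plane_wave k \<phi>)"
  by (rule continuous_on_torus3) (auto simp: o_def intro!: continuous_intros)

lemma plane_waves_separate_points:
  assumes "p \<noteq> q"
  shows "\<exists>k \<phi>. plane_wave k \<phi> p \<noteq> plane_wave k \<phi> q"
proof (rule ccontr)
  assume "\<not> ?thesis"
  then have eq: "plane_wave k \<phi> p = plane_wave k \<phi> q" for k \<phi> by blast
  obtain x y where p: "p = torus3_proj x" and q: "q = torus3_proj y"
    by (metis proj_rep)
  have "x $ i - y $ i \<in> \<int>" for i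
  proof -
    have ang: "angle (axis i 1) z = 2 * pi * z $ i" for z
    proof -
      have "real_of_int (axis i 1 $ j) * z $ j = (if j = i then z $ j else 0)" for j
        by (simp add: axis_def)
      then show ?thesis by (simp add: angle_def)
    qed
    have "cos (2 * pi * x $ i) = cos (2 * pi * y $ i)"
      using eq[of "axis i 1" 0] by (simp add: p q ang)
    moreover have "sin (2 * pi * x $ i) = sin (2 * pi * y $ i)"
      using eq[of "axis i 1" "pi / 2"] by (simp add: p q ang cos_add)
    ultimately obtain n :: int where "2 * pi * x $ i = 2 * pi * y $ i + 2 * pi * n"
      using sin_cos_eq_iff by blast
    then have "2 * pi * (x $ i - y $ i) = 2 * pi * n" by (simp add: algebra_simps)
    then have "x $ i - y $ i = of_int n" by simp
    then show ?thesis by simp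
  qed
  then have "p = q"
    by (simp add: p q torus3_proj_eq_iff int_equiv_def)
  with assms show False by contradiction
qed

text \<open>Plane waves are continuous and separate points, so the quotient topology is Hausdorff; this is
  what the Stone-Weierstrass theorem asks of its domain.\<close>

instance torus3 :: t2_space
proof
  fix p q :: torus3
  assume "p \<noteq> q"
  then obtain k \<phi> where ne: "plane_wave k \<phi> p \<noteq> plane_wave k \<phi> q"
    using plane_waves_separate_points by blast
  obtain U V where "open U" "open V" "plane_wave k \<phi> p \<in> U" "plane_wave k \<phi> q \<in> V" "U \<inter> V = {}"
    using hausdorff[OF ne] by blast
  moreover from this have "open (plane_wave k \<phi> -` U)" "open (plane_wave k \<phi> -` V)"
    by (auto intro: open_vimage continuous_plane_wave)
  ultimately show "\<exists>U V. open U \<and> open V \<and> p \<in> U \<and> q \<in> V \<and> U \<inter> V = {}"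
    by (intro exI[of _ "plane_wave k \<phi> -` U"] exI[of _ "plane_wave k \<phi> -` V"]) auto
qed

lemma torus3_proj_unit_cube_surj: "\<exists>x\<in>unit_cube. torus3_proj x = p"
proof -
  obtain y where y: "p = torus3_proj y" by (metis proj_rep)
  let ?x = "\<chi> i. frac (y $ i)"
  have "?x \<in> unit_cube" by (simp add: unit_cube_def frac_ge_0 frac_lt_1)
  moreover have "torus3_proj ?x = p"
    by (simp add: y torus3_proj_eq_iff int_equiv_def frac_def)
  ultimately show ?thesis by blast
qed

lemma unit_cube_subset_cbox: "unit_cube \<subseteq> cbox 0 1"
  by (auto simp: unit_cube_def mem_box_cart less_imp_le)

lemma compact_torus3: "compact (UNIV :: torus3 set)"
proof -
  have "compact (torus3_proj ` cbox 0 1)"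
    by (intro compact_continuous_image continuous_on_torus3_proj compact_cbox)
  moreover have "torus3_proj ` cbox 0 1 = UNIV"
  proof (intro set_eqI iffI UNIV_I)
    fix p :: torus3
    obtain x where "x \<in> unit_cube" "torus3_proj x = p"
      using torus3_proj_unit_cube_surj by blast
    then show "p \<in> torus3_proj ` cbox 0 1"
      using unit_cube_subset_cbox by auto
  qed
  ultimately show ?thesis by simp
qed

lemma continuous_torus3_bounded:
  fixes g :: "torus3 \<Rightarrow> real"
  assumes "continuous_on UNIV g"
  obtains c where "\<And>p. \<bar>g p\<bar> \<le> c"
  using compact_imp_bounded[OF compact_continuous_image[OF assms compact_torus3]]
  unfolding bounded_iff by auto

section \<open>Uniform approximation by trigonometric polynomials\<close>

inductive_set trig_polys :: "(torus3 \<Rightarrow> real) set" where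
  wave: "plane_wave k \<phi> \<in> trig_polys"
| add: "f \<in> trig_polys \<Longrightarrow> g \<in> trig_polys \<Longrightarrow> (\<lambda>p. f p + g p) \<in> trig_polys"
| scale: "f \<in> trig_polys \<Longrightarrow> (\<lambda>p. c * f p) \<in> trig_polys"

lemma plane_wave_mult:
  "plane_wave k \<phi> p * plane_wave l \<psi> p =
     1/2 * (plane_wave (k - l) (\<phi> - \<psi>) p + plane_wave (k + l) (\<phi> + \<psi>) p)"
  by (simp add: plane_wave_def angle_add angle_diff cos_times_cos algebra_simps)

lemma trig_polys_mult:
  assumes "f \<in> trig_polys" and "g \<in> trig_polys"
  shows "(\<lambda>p. f p * g p) \<in> trig_polys"
  using assms
proof (induction f rule: trig_polys.induct)
  case (wave k \<phi>)
  from wave show ?case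
  proof (induction g rule: trig_polys.induct)
    case (wave l \<psi>)
    show ?case unfolding plane_wave_mult by (intro trig_polys.intros)
  next
    case (add f g)
    then show ?case by (simp add: distrib_left trig_polys.add)
  next
    case (scale f c)
    then show ?case by (simp add: mult.left_commute trig_polys.scale)
  qed
next
  case (add f g)
  then show ?case by (simp add: distrib_right trig_polys.add)
next
  case (scale f c)
  then show ?case by (simp add: mult.assoc trig_polys.scale)
qed

lemma plane_wave_0: "plane_wave 0 \<phi> = (\<lambda>p. cos \<phi>)"
  by (rule ext) (simp add: plane_wave_def angle_zero)

lemma trig_polys_const: "(\<lambda>p. c) \<in> trig_polys"
  using trig_polys.scale[OF trig_polys.wave[of 0 0], of c] by (simp add: plane_wave_0)

lemma trig_polys_continuous: "f \<in> trig_polys \<Longrightarrow> continuous_on UNIV f"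
  by (induction rule: trig_polys.induct) (auto intro!: continuous_plane_wave continuous_intros)

lemma trig_polys_uniformly_dense:
  fixes g :: "torus3 \<Rightarrow> real"
  assumes "continuous_on UNIV g" and "0 < e"
  shows "\<exists>f\<in>trig_polys. \<forall>p. \<bar>g p - f p\<bar> < e"
proof -
  interpret function_ring_on trig_polys UNIV
    by unfold_locales
      (auto intro: compact_torus3 trig_polys_continuous trig_polys.add trig_polys_mult
        trig_polys_const dest: plane_waves_separate_points intro: trig_polys.wave)
  show ?thesis
    using Stone_Weierstrass_basic[OF assms] by auto
qed

section \<open>Mean values of plane waves\<close>

lemma sets_torus3_measure [measurable_cong, simp]: "sets torus3_measure = sets borel"
  by (simp add: torus3_measure_def)

lemma space_torus3_measure [simp]: "space torus3_measure = UNIV"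
  by (simp add: torus3_measure_def)

lemma measurable_torus3_measure [simp]: "borel_measurable torus3_measure = borel_measurable borel"
  by (rule measurable_cong_sets) simp_all

lemma unit_cube_borel [measurable]: "unit_cube \<in> sets borel"
proof -
  have "unit_cube = (\<Inter>i\<in>UNIV. {x. 0 \<le> x $ i} \<inter> {x. x $ i < 1})"
    by (auto simp: unit_cube_def)
  also have "\<dots> \<in> sets borel"
    by (intro sets.finite_INT sets.Int borel_closed borel_open closed_Collect_le open_Collect_less
        continuous_intros) auto
  finally show ?thesis .
qed

lemma integral_torus3:
  fixes f :: "torus3 \<Rightarrow> 'b::{banach, second_countable_topology}"
  assumes "f \<in> borel_measurable borel"
  shows "(LINT p|torus3_measure. f p) =
    (LINT x|lborel. indicator unit_cube x *\<^sub>R f (torus3_proj x))"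
  unfolding torus3_measure_def
  by (subst integral_distr[OF torus3_proj_measurable assms])
    (simp add: integral_restrict_space)

lemma emeasure_unit_cube_finite: "emeasure lborel unit_cube < \<infinity>"
  by (rule emeasure_bounded_finite) (rule bounded_subset[OF bounded_cbox unit_cube_subset_cbox])

lemma finite_measure_torus3: "finite_measure torus3_measure"
proof
  have "emeasure torus3_measure (space torus3_measure) = emeasure lborel unit_cube"
    by (simp add: torus3_measure_def emeasure_distr torus3_proj_measurable
        emeasure_restrict_space space_restrict_space)
  then show "emeasure torus3_measure (space torus3_measure) \<noteq> \<infinity>"
    using emeasure_unit_cube_finite by simp
qed

interpretation torus3: finite_measure torus3_measure
  by (rule finite_measure_torus3)

lemma integrable_torus3_bounded:
  fixes f :: "torus3 \<Rightarrow> 'b::{banach, second_countable_topology}"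
  assumes "f \<in> borel_measurable borel" and "\<And>p. norm (f p) \<le> c"
  shows "integrable torus3_measure f"
  by (rule torus3.integrable_const_bound[of _ c]) (use assms in auto)

lemma integral_cis_period:
  fixes n :: int
  defines "g \<equiv> \<lambda>t. indicator {0..<1} t *\<^sub>R cis (2 * pi * of_int n * t)"
  shows "integrable lborel g" and "(LINT t|lborel. g t) = (if n = 0 then 1 else 0)"
proof -
  define h where "h = (\<lambda>t::real. indicator {0..1} t *\<^sub>R cis (2 * pi * of_int n * t))"
  have [measurable]: "g \<in> borel_measurable borel" "h \<in> borel_measurable borel"
    unfolding g_def h_def cis.ctr
    by (intro borel_measurable_scaleR borel_measurable_indicator borel_measurable_continuous_onI
        continuous_intros; simp)+
  have ae: "AE t in lborel. g t = h t"
    using AE_lborel_singleton[of 1] by eventually_elim (auto simp: g_def h_def indicator_def)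
  have "integrable lborel h"
    unfolding h_def by (intro borel_integrable_compact continuous_intros) auto
  with ae show "integrable lborel g"
    by (subst integrable_cong_AE[of _ _ h]) auto
  have "(LINT t|lborel. g t) = (LINT t|lborel. h t)"
    by (rule integral_cong_AE) (use ae in auto)
  also have "\<dots> = (if n = 0 then 1 else 0)"
  proof (cases "n = 0")
    case True
    then show ?thesis by (simp add: h_def)
  next
    case False
    \<comment> \<open>For \<open>n \<noteq> 0\<close> the antiderivative \<open>cis (w t) / (i w)\<close> has period 1.\<close>
    define w where "w = 2 * pi * real_of_int n"
    have w: "w \<noteq> 0" using False by (simp add: w_def)
    have d: "((\<lambda>t. - \<i> / of_real w * cis (w * t)) has_vector_derivative cis (w * t)) (at t within {0..1})" for t
    proof -
      have "((\<lambda>z. - \<i> / of_real w * exp (\<i> * (of_real w * z))) has_field_derivative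
          cis (w * t)) (at (of_real t))"
        by (auto intro!: derivative_eq_intros simp: w cis_conv_exp)
      from has_vector_derivative_real_field[OF this] show ?thesis
        by (simp add: cis_conv_exp)
    qed
    have "(LINT t|lborel. h t) = - \<i> / of_real w * cis (w * 1) - - \<i> / of_real w * cis (w * 0)"
      unfolding h_def w_def[symmetric]
      by (rule integral_FTC_atLeastAtMost) (use d in \<open>auto intro!: continuous_intros\<close>)
    also have "cis (w * 1) = 1"
      by (simp add: w_def cis_multiple_2pi)
    finally show ?thesis using False by simp
  qed
  finally show "(LINT t|lborel. g t) = (if n = 0 then 1 else 0)" .
qed

lemma cis_unit_cube_measurable [measurable]:
  "(\<lambda>x. indicator unit_cube x *\<^sub>R cis (angle k x)) \<in> borel_measurable borel"
  unfolding cis.ctr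
  by (intro borel_measurable_scaleR borel_measurable_indicator borel_measurable_continuous_onI
      continuous_intros; simp)

text \<open>The exponential and the indicator of the cube both factor over the coordinates, so Fubini
  reduces the integral to the one over a period in each coordinate.\<close>

lemma integral_cis_unit_cube:
  "(LINT x|lborel. indicator unit_cube x *\<^sub>R cis (angle k x)) = (if k = 0 then 1 else 0)"
proof -
  define K :: "real ^ 3 \<Rightarrow> int" where "K b = (\<Sum>i\<in>UNIV. if b = axis i 1 then k $ i else 0)" for b
  have K: "K (axis i 1) = k $ i" for i
    by (simp add: K_def axis_eq_axis)
  have Basis: "(Basis :: (real ^ 3) set) = range (\<lambda>i. axis i 1)"
    by (auto simp: Basis_vec_def)
  have inj: "inj (\<lambda>i::3. axis i (1::real))"
    by (auto intro!: injI simp: axis_eq_axis)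
  define X where "X f = (\<Sum>b\<in>Basis. f b *\<^sub>R b)" for f :: "real ^ 3 \<Rightarrow> real"
  have X: "X f $ i = f (axis i 1)" for f i
  proof -
    have "X f $ i = X f \<bullet> axis i 1" by (simp add: inner_axis)
    also have "\<dots> = f (axis i 1)" 
      unfolding X_def by (rule inner_sum_left_Basis) (simp add: Basis)
    finally show ?thesis .
  qed
  have [measurable]: "X \<in> (\<Pi>\<^sub>M b\<in>Basis. lborel) \<rightarrow>\<^sub>M borel"
    unfolding X_def by measurable
  have factor: "indicator unit_cube (X f) *\<^sub>R cis (angle k (X f)) =
      (\<Prod>b\<in>Basis. indicator {0..<1} (f b) *\<^sub>R cis (2 * pi * of_int (K b) * f b))" for f
  proof -
    have "(\<Prod>b\<in>Basis. indicator {0..<1} (f b) *\<^sub>R cis (2 * pi * of_int (K b) * f b)) =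
        (\<Prod>i\<in>UNIV. indicator {0..<1} (X f $ i) *\<^sub>R cis (2 * pi * of_int (k $ i) * X f $ i))"
      unfolding Basis by (subst prod.reindex[OF inj]) (simp add: K X)
    also have "\<dots> = (\<Prod>i\<in>UNIV. of_real (indicator {0..<1} (X f $ i))) *
        (\<Prod>i\<in>UNIV. cis (2 * pi * of_int (k $ i) * X f $ i))"
      by (simp add: scaleR_conv_of_real prod.distrib)
    also have "(\<Prod>i\<in>UNIV. complex_of_real (indicator {0..<1} (X f $ i))) = of_real (indicator unit_cube (X f))"
      by (auto simp: unit_cube_def indicator_def)
    also have "(\<Prod>i\<in>UNIV. cis (2 * pi * of_int (k $ i) * X f $ i)) = cis (angle k (X f))"
      by (simp add: cis_conv_exp angle_def exp_sum[symmetric] sum_distrib_left mult.assoc)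
    finally show ?thesis by (simp add: scaleR_conv_of_real)
  qed
  interpret product_sigma_finite "\<lambda>b::real^3. lborel :: real measure" by standard
  have "(LINT x|lborel. indicator unit_cube x *\<^sub>R cis (angle k x)) =
      (LINT f|(\<Pi>\<^sub>M b\<in>Basis. lborel). indicator unit_cube (X f) *\<^sub>R cis (angle k (X f)))"
    by (subst lborel_eq, subst integral_distr) (auto simp: X_def[symmetric])
  also have "\<dots> = (\<Prod>b\<in>Basis. LINT t|lborel. indicator {0..<1} t *\<^sub>R cis (2 * pi * of_int (K b) * t))"
    unfolding factor by (rule product_integral_prod) (auto intro: integral_cis_period)
  also have "\<dots> = (\<Prod>b\<in>Basis. if K b = 0 then 1 else 0)"
    by (simp only: integral_cis_period)
  also have "\<dots> = (\<Prod>i\<in>UNIV. if k $ i = 0 then 1 else 0)"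
    unfolding Basis by (subst prod.reindex[OF inj]) (simp add: K)
  also have "\<dots> = (if k = 0 then 1 else 0)"
    by (auto simp: vec_eq_iff)
  finally show ?thesis .
qed

lemma plane_wave_measurable [measurable]: "plane_wave k \<phi> \<in> borel_measurable borel"
  by (rule borel_measurable_continuous_onI) (rule continuous_plane_wave)

lemma integrable_plane_wave [simp]: "integrable torus3_measure (plane_wave k \<phi>)"
  by (rule integrable_torus3_bounded[of _ 1]) (auto simp: plane_wave_def)

lemma plane_wave_mean:
  "(LINT p|torus3_measure. plane_wave k \<phi> p) = (if k = 0 then cos \<phi> else 0)"
proof -
  let ?e = "\<lambda>x. indicator unit_cube x *\<^sub>R cis (angle k x)"
  have "integrable lborel (indicator unit_cube :: real^3 \<Rightarrow> real)"
    using emeasure_unit_cube_finite by (intro integrable_real_indicator) auto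
  then have int: "integrable lborel ?e"
    by (rule Bochner_Integration.integrable_bound)
      (use cis_unit_cube_measurable[of k] in \<open>auto simp: indicator_def\<close>)
  have "(LINT p|torus3_measure. plane_wave k \<phi> p) =
      (LINT x|lborel. Re (cis \<phi> * ?e x))"
    by (subst integral_torus3) (auto simp: cos_add algebra_simps indicator_def intro!: Bochner_Integration.integral_cong)
  also have "\<dots> = Re (LINT x|lborel. cis \<phi> * ?e x)"
    by (rule integral_Re) (rule integrable_mult_right[OF int])
  also have "\<dots> = Re (cis \<phi> * (LINT x|lborel. ?e x))"
    by (simp only: integral_mult_right_zero)
  also have "\<dots> = (if k = 0 then cos \<phi> else 0)"
    by (simp add: integral_cis_unit_cube)
  finally show ?thesis .
qed

text \<open>The product of two plane waves is a half sum of plane waves with frequencies \<open>k - l\<close> and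
  \<open>k + l\<close>. Keeping only one frequency out of each pair \<open>\<plusminus>k\<close> makes the second mean vanish.\<close>

lemma plane_wave_product_mean:
  assumes "k + l \<noteq> 0"
  shows "(LINT p|torus3_measure. plane_wave k \<phi> p * plane_wave l \<psi> p) =
    (if k = l then cos (\<phi> - \<psi>) / 2 else 0)"
  using assms by (simp add: plane_wave_mult plane_wave_mean)

section \<open>Density of trigonometric polynomials in the square integrable functions\<close>

text \<open>The square of the distance on \<open>L\<^sup>2\<close>. Its weak triangle inequality, with a factor 2, replaces
  that of Minkowski in the approximation arguments.\<close>

definition sq_dist :: "(torus3 \<Rightarrow> complex) \<Rightarrow> (torus3 \<Rightarrow> complex) \<Rightarrow> real" where
  "sq_dist f g = (LINT p|torus3_measure. (cmod (f p - g p))\<^sup>2)"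

lemma sq_norm_add_le:
  fixes a b :: "'a::real_normed_vector"
  shows "(norm (a + b))\<^sup>2 \<le> 2 * (norm a)\<^sup>2 + 2 * (norm b)\<^sup>2"
proof -
  have "(norm (a + b))\<^sup>2 \<le> (norm a + norm b)\<^sup>2"
    by (intro power_mono norm_triangle_ineq norm_ge_zero)
  also have "\<dots> \<le> 2 * (norm a)\<^sup>2 + 2 * (norm b)\<^sup>2"
    using zero_le_power2[of "norm a - norm b"] by (simp add: power2_eq_square algebra_simps)
  finally show ?thesis .
qed

lemma L2_iff: "f \<in> L2_torus3 \<longleftrightarrow>
    f \<in> borel_measurable borel \<and> integrable torus3_measure (\<lambda>p. (cmod (f p))\<^sup>2)"
  by (simp add: L2_torus3_def)

lemma L2_add:
  assumes "f \<in> L2_torus3" and "g \<in> L2_torus3"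
  shows "(\<lambda>p. f p + g p) \<in> L2_torus3"
proof -
  have [measurable]: "f \<in> borel_measurable borel" "g \<in> borel_measurable borel"
    using assms by (auto simp: L2_iff)
  have "integrable torus3_measure (\<lambda>p. 2 * (cmod (f p))\<^sup>2 + 2 * (cmod (g p))\<^sup>2)"
    using assms by (auto simp: L2_iff)
  then have "integrable torus3_measure (\<lambda>p. (cmod (f p + g p))\<^sup>2)"
    by (rule Bochner_Integration.integrable_bound) (auto intro: sq_norm_add_le)
  then show ?thesis by (simp add: L2_iff)
qed

lemma L2_scale: "f \<in> L2_torus3 \<Longrightarrow> (\<lambda>p. c * f p) \<in> L2_torus3"
  by (auto simp: L2_iff norm_mult power_mult_distrib intro: borel_measurable_times)

lemma L2_diff: "f \<in> L2_torus3 \<Longrightarrow> g \<in> L2_torus3 \<Longrightarrow> (\<lambda>p. f p - g p) \<in> L2_torus3"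
  using L2_add[OF _ L2_scale[of g "-1"]] by simp

lemma L2_bounded:
  assumes "f \<in> borel_measurable borel" and "\<And>p. cmod (f p) \<le> c"
  shows "f \<in> L2_torus3"
proof -
  have "(cmod (f p))\<^sup>2 \<le> c\<^sup>2" for p
    using assms(2) by (intro power_mono) auto
  then show ?thesis
    using assms(1) by (auto simp: L2_iff intro!: integrable_torus3_bounded[of _ "c\<^sup>2"])
qed

lemma sq_dist_add_le:
  assumes "f \<in> L2_torus3" "f' \<in> L2_torus3" "g \<in> L2_torus3" "g' \<in> L2_torus3"
  shows "sq_dist (\<lambda>p. f p + g p) (\<lambda>p. f' p + g' p) \<le> 2 * sq_dist f f' + 2 * sq_dist g g'"
proof -
  have i: "integrable torus3_measure (\<lambda>p. (cmod (u p - v p))\<^sup>2)"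
    if "u \<in> L2_torus3" "v \<in> L2_torus3" for u v
    using L2_diff[OF that] by (simp add: L2_iff)
  have "sq_dist (\<lambda>p. f p + g p) (\<lambda>p. f' p + g' p) \<le>
      (LINT p|torus3_measure. 2 * (cmod (f p - f' p))\<^sup>2 + 2 * (cmod (g p - g' p))\<^sup>2)"
    unfolding sq_dist_def
  proof (rule integral_mono)
    show "integrable torus3_measure (\<lambda>p. (cmod (f p + g p - (f' p + g' p)))\<^sup>2)"
      using assms by (intro i L2_add)
    show "(cmod (f p + g p - (f' p + g' p)))\<^sup>2 \<le> 2 * (cmod (f p - f' p))\<^sup>2 + 2 * (cmod (g p - g' p))\<^sup>2" for p
      using sq_norm_add_le[of "f p - f' p" "g p - g' p"] by (simp add: algebra_simps)
  qed (use assms i in auto)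
  also have "\<dots> = 2 * sq_dist f f' + 2 * sq_dist g g'"
    unfolding sq_dist_def using assms i by simp
  finally show ?thesis .
qed

lemma sq_dist_triangle:
  assumes "f \<in> L2_torus3" "g \<in> L2_torus3" "h \<in> L2_torus3"
  shows "sq_dist f h \<le> 2 * sq_dist f g + 2 * sq_dist g h"
  using sq_dist_add_le[of "\<lambda>p. f p - g p" "\<lambda>p. 0" g h] assms
  by (simp add: L2_diff L2_bounded[of "\<lambda>p. 0" 0] sq_dist_def)

lemma sq_dist_scale: "sq_dist (\<lambda>p. c * f p) (\<lambda>p. c * g p) = (cmod c)\<^sup>2 * sq_dist f g"
  by (simp add: sq_dist_def right_diff_distrib[symmetric] norm_mult power_mult_distrib)

lemma sq_dist_dominated_convergence:
  assumes "f \<in> borel_measurable borel" and "\<And>n. s n \<in> borel_measurable borel"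
    and lim: "\<And>p. (\<lambda>n. s n p) \<longlonglongrightarrow> f p"
    and dom: "\<And>n p. cmod (s n p) \<le> w p"
    and w: "integrable torus3_measure (\<lambda>p. (w p)\<^sup>2)"
  shows "f \<in> L2_torus3" and "(\<lambda>n. sq_dist f (s n)) \<longlonglongrightarrow> 0"
proof -
  note [measurable] = assms(1,2)
  have fw: "cmod (f p) \<le> w p" for p
    by (rule tendsto_upperbound[OF tendsto_norm[OF lim]]) (auto simp: dom)
  have w0: "0 \<le> w p" for p
    using fw[of p] norm_ge_zero order_trans by blast
  show "f \<in> L2_torus3"
    unfolding L2_iff
  proof (intro conjI assms(1) Bochner_Integration.integrable_bound[OF w])
    show "AE p in torus3_measure. norm ((cmod (f p))\<^sup>2) \<le> norm ((w p)\<^sup>2)"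
      using fw by (auto intro!: power_mono)
  qed auto
  have bound: "norm ((cmod (f p - s n p))\<^sup>2) \<le> 4 * (w p)\<^sup>2" for n p
  proof -
    have "cmod (f p - s n p) \<le> 2 * w p"
      using norm_triangle_ineq4[of "f p" "s n p"] fw[of p] dom[of n p] by simp
    then have "(cmod (f p - s n p))\<^sup>2 \<le> (2 * w p)\<^sup>2" by (intro power_mono) auto
    then show ?thesis by (simp add: power_mult_distrib)
  qed
  have "(\<lambda>n. sq_dist f (s n)) \<longlonglongrightarrow> (LINT p|torus3_measure. 0)"
    unfolding sq_dist_def
  proof (rule integral_dominated_convergence[where w = "\<lambda>p. 4 * (w p)\<^sup>2"])
    show "AE p in torus3_measure. (\<lambda>n. (cmod (f p - s n p))\<^sup>2) \<longlonglongrightarrow> 0"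
    proof (rule AE_I2)
      fix p
      have "(\<lambda>n. (cmod (f p - s n p))\<^sup>2) \<longlonglongrightarrow> (cmod (f p - f p))\<^sup>2"
        by (intro tendsto_intros lim)
      then show "(\<lambda>n. (cmod (f p - s n p))\<^sup>2) \<longlonglongrightarrow> 0" by simp
    qed
  qed (use w bound in auto)
  then show "(\<lambda>n. sq_dist f (s n)) \<longlonglongrightarrow> 0" by simp
qed

text \<open>Subspaces of \<open>L\<^sup>2\<close> whose elements are actual functions, not classes modulo null sets.\<close>

locale L2_subspace =
  fixes V :: "(torus3 \<Rightarrow> complex) set"
  assumes subset_L2: "V \<subseteq> L2_torus3"
    and V_add: "f \<in> V \<Longrightarrow> g \<in> V \<Longrightarrow> (\<lambda>p. f p + g p) \<in> V"
    and V_scale: "f \<in> V \<Longrightarrow> (\<lambda>p. c * f p) \<in> V"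
begin

definition L2_closure :: "(torus3 \<Rightarrow> complex) set" where
  "L2_closure = {f \<in> L2_torus3. \<forall>e>0. \<exists>g\<in>V. sq_dist f g < e}"

lemma closure_L2: "f \<in> L2_closure \<Longrightarrow> f \<in> L2_torus3"
  by (simp add: L2_closure_def)

lemma closureE:
  assumes "f \<in> L2_closure" and "0 < e"
  obtains g where "g \<in> V" "g \<in> L2_torus3" "sq_dist f g < e"
  using assms subset_L2 unfolding L2_closure_def by blast

lemma subset_closure: "V \<subseteq> L2_closure"
proof
  fix f assume "f \<in> V"
  moreover have "sq_dist f f = 0" by (simp add: sq_dist_def)
  ultimately show "f \<in> L2_closure" using subset_L2 unfolding L2_closure_def by force
qed

lemma closure_add:
  assumes "f \<in> L2_closure" and "g \<in> L2_closure"
  shows "(\<lambda>p. f p + g p) \<in> L2_closure"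
proof -
  have "\<exists>h\<in>V. sq_dist (\<lambda>p. f p + g p) h < e" if "0 < e" for e
  proof -
    have "0 < e / 4" using that by simp
    obtain f' where f': "f' \<in> V" "f' \<in> L2_torus3" "sq_dist f f' < e / 4"
      by (rule closureE[OF assms(1) \<open>0 < e / 4\<close>])
    obtain g' where g': "g' \<in> V" "g' \<in> L2_torus3" "sq_dist g g' < e / 4"
      by (rule closureE[OF assms(2) \<open>0 < e / 4\<close>])
    have "sq_dist (\<lambda>p. f p + g p) (\<lambda>p. f' p + g' p) < e"
      using sq_dist_add_le[of f f' g g'] f' g' assms[THEN closure_L2] by simp
    with f' g' show ?thesis by (intro bexI[of _ "\<lambda>p. f' p + g' p"] V_add)
  qed
  then show ?thesis
    using assms[THEN closure_L2] by (simp add: L2_closure_def L2_add)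
qed

lemma closure_scale:
  assumes "f \<in> L2_closure"
  shows "(\<lambda>p. c * f p) \<in> L2_closure"
proof -
  have "\<exists>h\<in>V. sq_dist (\<lambda>p. c * f p) h < e" if "0 < e" for e
  proof -
    have pos: "0 < (cmod c)\<^sup>2 + 1" by (simp add: add_nonneg_pos)
    have "0 < e / ((cmod c)\<^sup>2 + 1)" using that pos by simp
    then obtain g where g: "g \<in> V" "g \<in> L2_torus3" "sq_dist f g < e / ((cmod c)\<^sup>2 + 1)"
      by (rule closureE[OF assms])
    have "0 \<le> sq_dist f g" by (simp add: sq_dist_def)
    then have "(cmod c)\<^sup>2 * sq_dist f g \<le> ((cmod c)\<^sup>2 + 1) * sq_dist f g"
      by (intro mult_right_mono) auto
    also have "\<dots> < e"
      using g(3) pos by (simp add: pos_less_divide_eq mult.commute)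
    finally have "sq_dist (\<lambda>p. c * f p) (\<lambda>p. c * g p) < e" by (simp add: sq_dist_scale)
    with g show ?thesis by (intro bexI[of _ "\<lambda>p. c * g p"] V_scale)
  qed
  then show ?thesis
    using closure_L2[OF assms] by (simp add: L2_closure_def L2_scale)
qed

text \<open>The closure is stable under dominated pointwise limits. All later limit steps go through this
  lemma.\<close>

lemma closure_limit:
  assumes "\<And>n. s n \<in> L2_closure" and lim: "\<And>p. (\<lambda>n. s n p) \<longlonglongrightarrow> f p"
    and dom: "\<And>n p. cmod (s n p) \<le> w p"
    and w: "integrable torus3_measure (\<lambda>p. (w p)\<^sup>2)"
  shows "f \<in> L2_closure"
proof -
  have sL2: "s n \<in> L2_torus3" for n by (rule closure_L2[OF assms(1)])
  then have smeas: "s n \<in> borel_measurable borel" for n by (simp add: L2_iff)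
  have fmeas: "f \<in> borel_measurable borel"
    by (rule borel_measurable_LIMSEQ_metric[OF smeas lim])
  note conv = sq_dist_dominated_convergence[OF fmeas smeas lim dom w]
  have "\<exists>g\<in>V. sq_dist f g < e" if "0 < e" for e
  proof -
    have e4: "0 < e / 4" using that by simp
    have "\<forall>\<^sub>F n in sequentially. sq_dist f (s n) < e / 4"
      by (rule order_tendstoD(2)[OF conv(2) e4])
    then obtain n where n: "sq_dist f (s n) < e / 4"
      by (auto simp: eventually_sequentially)
    obtain g where g: "g \<in> V" "g \<in> L2_torus3" "sq_dist (s n) g < e / 4"
      by (rule closureE[OF assms(1) e4])
    have "sq_dist f g < e"
      using sq_dist_triangle[OF conv(1) sL2[of n] g(2)] n g(3) by simp
    with g(1) show ?thesis by blast
  qed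
  with conv(1) show ?thesis by (simp add: L2_closure_def)
qed

end

text \<open>The functions \<open>min 1 (n d)\<close> increase to the indicator of an open set if \<open>d\<close> is the distance to
  its complement. The distance is taken upstairs in \<open>\<real>\<^sup>3\<close>, where it is invariant under integer
  translations because the lifted complement is.\<close>

lemma open_indicator_continuous_limit:
  assumes "open (U :: torus3 set)"
  obtains g :: "nat \<Rightarrow> torus3 \<Rightarrow> real"
  where "\<And>n. continuous_on UNIV (g n)" "\<And>n p. 0 \<le> g n p" "\<And>n p. g n p \<le> 1"
    "\<And>p. (\<lambda>n. g n p) \<longlonglongrightarrow> indicator U p"
proof (cases "U = UNIV")
  \<comment> \<open>The distance to the empty set is 0 by convention, so this case is separate.\<close>
  case True
  show ?thesis by (rule that[of "\<lambda>n p. 1"]) (auto simp: True)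
next
  case False
  define C where "C = - (torus3_proj -` U)"
  have "closed C" using assms by (simp add: C_def closed_Compl open_torus3_def)
  have "C \<noteq> {}" using False surj_torus3_proj unfolding C_def by (metis Compl_UNIV_eq double_compl subsetI subset_antisym surj_image_vimage_eq top_greatest vimage_UNIV)
  have periodic: "infdist x C = infdist y C" if "int_equiv x y" for x y
  proof -
    have shift: "dist x ` C \<subseteq> dist y ` C" if "int_equiv x y" for x y
    proof
      fix r assume "r \<in> dist x ` C"
      then obtain a where a: "a \<in> C" "r = dist x a" by blast
      have "int_equiv (a + (y - x)) a"
        using that unfolding int_equiv_def by (metis Ints_minus add_diff_cancel_left' minus_diff_eq vector_minus_component)
      then have "a + (y - x) \<in> C"
        using a(1) by (simp add: C_def torus3_proj_eq_iff[symmetric])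
      moreover have "r = dist y (a + (y - x))"
        by (simp add: a(2) dist_norm)
      ultimately show "r \<in> dist y ` C" by blast
    qed
    have "int_equiv y x" using that by (metis torus3_proj_eq_iff)
    then have "dist x ` C = dist y ` C" using shift that by blast
    then show ?thesis using \<open>C \<noteq> {}\<close> by (simp add: infdist_def)
  qed
  define g where "g n p = min 1 (real n * infdist (rep_torus3 p) C)" for n p
  have g_proj: "g n (torus3_proj x) = min 1 (real n * infdist x C)" for n x
    using periodic[OF int_equiv_rep_proj] by (simp add: g_def)
  show ?thesis
  proof (rule that[of g])
    show "continuous_on UNIV (g n)" for n
      by (rule continuous_on_torus3) (auto simp: o_def g_proj intro!: continuous_intros)
    show "0 \<le> g n p" "g n p \<le> 1" for n p
      by (auto simp: g_def infdist_nonneg)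
    fix p
    let ?d = "infdist (rep_torus3 p) C"
    show "(\<lambda>n. g n p) \<longlonglongrightarrow> indicator U p"
    proof (cases "p \<in> U")
      case True
      then have "rep_torus3 p \<notin> C" by (simp add: C_def)
      then have "0 < ?d"
        using in_closed_iff_infdist_zero[OF \<open>closed C\<close> \<open>C \<noteq> {}\<close>] infdist_nonneg[of "rep_torus3 p" C]
        by (metis less_eq_real_def)
      then obtain N :: nat where "1 < real N * ?d" using reals_Archimedean3 by blast
      then have "1 \<le> real n * ?d" if "N \<le> n" for n
        using that \<open>0 < ?d\<close> by (meson dual_order.strict_implies_order mult_right_mono of_nat_mono order.trans)
      then have "\<forall>\<^sub>F n in sequentially. g n p = 1"
        by (intro eventually_sequentiallyI[of N]) (simp add: g_def)
      then show ?thesis using True by (simp add: tendsto_eventually)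
    next
      case False
      then have "rep_torus3 p \<in> C" by (simp add: C_def)
      then show ?thesis using False by (simp add: g_def)
    qed
  qed
qed

locale trig_L2_subspace = L2_subspace +
  assumes plane_waves: "(\<lambda>p. of_real (plane_wave k \<phi> p)) \<in> V"
begin

lemma trig_polys_in: "f \<in> trig_polys \<Longrightarrow> (\<lambda>p. of_real (f p)) \<in> V"
proof (induction rule: trig_polys.induct)
  case (wave k \<phi>)
  show ?case by (rule plane_waves)
next
  case (add f g)
  show ?case unfolding of_real_add by (rule V_add[OF add.IH])
next
  case (scale f c)
  show ?case unfolding of_real_mult by (rule V_scale[OF scale.IH])
qed

lemma continuous_in_closure:
  fixes g :: "torus3 \<Rightarrow> real"
  assumes g: "continuous_on UNIV g"
  shows "(\<lambda>p. of_real (g p)) \<in> L2_closure"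
proof -
  have "\<exists>f. f \<in> trig_polys \<and> (\<forall>p. \<bar>g p - f p\<bar> < 1 / real (Suc n))" for n
    using trig_polys_uniformly_dense[OF g, of "1 / real (Suc n)"] by auto
  then obtain s where s: "\<And>n. s n \<in> trig_polys" "\<And>n p. \<bar>g p - s n p\<bar> < 1 / real (Suc n)"
    by metis
  obtain c where c: "\<And>p. \<bar>g p\<bar> \<le> c"
    using continuous_torus3_bounded[OF g] by blast
  show ?thesis
  proof (rule closure_limit[where s = "\<lambda>n p. of_real (s n p)" and w = "\<lambda>p. c + 1"])
    show "(\<lambda>p. of_real (s n p)) \<in> L2_closure" for n
      using subset_closure trig_polys_in[OF s(1)] by blast
    fix p
    have "(\<lambda>n. g p - s n p) \<longlonglongrightarrow> 0"
      by (rule Lim_null_comparison[OF _ LIMSEQ_Suc[OF lim_1_over_n]])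
        (use s(2)[of p] in \<open>auto simp: less_imp_le\<close>)
    then have "(\<lambda>n. g p - (g p - s n p)) \<longlonglongrightarrow> g p - 0" by (intro tendsto_diff tendsto_const)
    then show "(\<lambda>n. complex_of_real (s n p)) \<longlonglongrightarrow> of_real (g p)" by (intro tendsto_of_real) simp
    fix n
    have "1 / real (Suc n) \<le> 1" by simp
    then have "\<bar>g p - s n p\<bar> < 1" using s(2)[of p n] by (rule order.strict_trans2[rotated])
    then show "cmod (of_real (s n p)) \<le> c + 1"
      using c[of p] by simp
  qed simp
qed

text \<open>The Borel sets with indicator in the closure form a Dynkin system, and it contains the open sets,
  which are closed under intersection and generate.\<close>

lemma indicator_in_closure:
  assumes "A \<in> sets borel"
  shows "indicator A \<in> L2_closure"
proof -
  have "Int_stable {S :: torus3 set. open S}" by (auto simp: Int_stable_def)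
  moreover have "{S :: torus3 set. open S} \<subseteq> Pow UNIV" by simp
  moreover have "A \<in> sigma_sets UNIV {S :: torus3 set. open S}"
    using assms by (simp add: sets_borel)
  ultimately show ?thesis
  proof (induction A rule: sigma_sets_induct_disjoint)
    case (basic U)
    then have "open U" by simp
    then obtain g :: "nat \<Rightarrow> torus3 \<Rightarrow> real" where g: "\<And>n. continuous_on UNIV (g n)"
      "\<And>n p. 0 \<le> g n p" "\<And>n p. g n p \<le> 1" "\<And>p. (\<lambda>n. g n p) \<longlonglongrightarrow> indicator U p"
      by (rule open_indicator_continuous_limit) blast
    have "(\<lambda>n. complex_of_real (g n p)) \<longlonglongrightarrow> indicator U p" for p
      using tendsto_of_real[OF g(4)[of p], where 'a = complex] by (simp add: indicator_def of_bool_def split: if_splits)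
    then show ?case
      by (rule closure_limit[OF continuous_in_closure[OF g(1)], where w = "\<lambda>p. 1"])
        (use g in auto)
  next
    case empty
    then show ?case
      using continuous_in_closure[of "\<lambda>p. 0"] by (simp add: indicator_def[abs_def])
  next
    case (compl A)
    have "(\<lambda>p. 1 + - 1 * indicator A p) \<in> L2_closure"
      using closure_add[OF continuous_in_closure[of "\<lambda>p. 1"] closure_scale[OF compl.IH, of "- 1"]] by simp
    moreover have "indicator (UNIV - A) = (\<lambda>p. 1 + - 1 * indicator A p :: complex)"
      by (auto simp: fun_eq_iff indicator_def)
    ultimately show ?case by (simp only:)
  next
    case (union A)
    have part: "(\<lambda>p. \<Sum>i<n. indicator (A i) p) \<in> L2_closure" for n
    proof (induction n)
      case 0
      then show ?case using continuous_in_closure[of "\<lambda>p. 0"] by simp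
    next
      case (Suc n)
      then show ?case using closure_add[OF Suc union.IH[of n]] by simp
    qed
    have sum_eq: "(\<Sum>i<n. indicator (A i) p) = (indicator (\<Union>i<n. A i) p :: complex)" for n p
      by (subst indicator_UN_disjoint)
        (use union.hyps in \<open>auto simp: disjoint_family_on_def\<close>)
    show ?case
    proof (rule closure_limit[OF part, where w = "\<lambda>p. 1"])
      show "(\<lambda>n. \<Sum>i<n. indicator (A i) p) \<longlonglongrightarrow> (indicator (\<Union> (range A)) p :: complex)" for p
        unfolding sum_eq by (rule LIMSEQ_indicator_UN)
      show "cmod (\<Sum>i<n. indicator (A i) p) \<le> 1" for n p
        unfolding sum_eq by (simp add: indicator_def)
    qed simp
  qed
qed

text \<open>A square integrable \<open>f\<close> is the pointwise limit of simple functions dominated by \<open>2 |f|\<close>.\<close>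

lemma closure_eq_L2: "L2_closure = L2_torus3"
proof
  show "L2_closure \<subseteq> L2_torus3" by (auto simp: closure_L2)
  show "L2_torus3 \<subseteq> L2_closure"
  proof
    fix f assume f: "f \<in> L2_torus3"
    then have "f \<in> borel_measurable torus3_measure" by (simp add: L2_iff)
    then obtain s where s: "\<And>n. simple_function torus3_measure (s n)"
      "\<And>p. (\<lambda>n. s n p) \<longlonglongrightarrow> f p" "\<And>n p. cmod (s n p) \<le> 2 * cmod (f p)"
      using borel_measurable_implies_sequence_metric[of f torus3_measure 0] by auto
    have "s n \<in> L2_closure" for n
    proof -
      have sum: "(\<lambda>p. \<Sum>y\<in>Y. y * indicator (s n -` {y}) p) \<in> L2_closure" if "finite Y" for Y
        using that
      proof (induction Y)
        case empty
        then show ?case using continuous_in_closure[of "\<lambda>p. 0"] by simp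
      next
        case (insert y Y)
        have "s n -` {y} \<in> sets borel"
          using simple_functionD(2)[OF s(1), of n "{y}"] by simp
        then have "(\<lambda>p. y * indicator (s n -` {y}) p) \<in> L2_closure"
          by (intro closure_scale indicator_in_closure)
        from closure_add[OF this insert.IH] show ?case
          by (simp only: sum.insert[OF insert.hyps])
      qed
      have "s n = (\<lambda>p. \<Sum>y\<in>range (s n). y * indicator (s n -` {y}) p)"
      proof (rule ext)
        fix p
        have "s n p = (\<Sum>y\<in>range (s n). indicator (s n -` {y}) p *\<^sub>R y)"
          using simple_function_indicator_representation_banach[OF s(1)[of n], of p]
          by (simp only: space_torus3_measure UNIV_I Int_UNIV_right)
        also have "\<dots> = (\<Sum>y\<in>range (s n). y * indicator (s n -` {y}) p)"
          by (intro sum.cong) (auto simp: indicator_def)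
        finally show "s n p = (\<Sum>y\<in>range (s n). y * indicator (s n -` {y}) p)" .
      qed
      also have "\<dots> \<in> L2_closure"
        using simple_functionD(1)[OF s(1)[of n]] by (intro sum) simp
      finally show ?thesis .
    qed
    then show "f \<in> L2_closure"
      by (rule closure_limit[where w = "\<lambda>p. 2 * cmod (f p)"])
        (use s f in \<open>auto simp: L2_iff power_mult_distrib\<close>)
  qed
qed

end

section \<open>Positivity sets of sums of cosines\<close>

text \<open>The maxima of \<open>a cos\<close> are spaced \<open>2 \<pi>\<close> apart, so every point is within \<open>\<pi>\<close> of one of them. The
  sign of \<open>a\<close> is absorbed into the position of the maximum.\<close>

lemma nearest_peak:
  fixes a u :: real
  obtains q where "\<And>x. a * cos x = \<bar>a\<bar> * cos (x - q)" and "\<bar>u - q\<bar> \<le> pi"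
proof -
  define \<theta> where "\<theta> = (if 0 \<le> a then 0 else pi)"
  define n where "n = round ((u - \<theta>) / (2 * pi))"
  show ?thesis
  proof (rule that[of "\<theta> + 2 * pi * of_int n"])
    fix x
    have "cos (x - (\<theta> + 2 * pi * of_int n)) = cos ((x - \<theta>) - 2 * pi * of_int n)"
      by (simp add: algebra_simps)
    also have "\<dots> = cos (x - \<theta>)"
      by (simp only: cos_diff[of _ "2 * pi * of_int n"] cos_int_2pin sin_int_2pin)
    finally show "a * cos x = \<bar>a\<bar> * cos (x - (\<theta> + 2 * pi * of_int n))"
      by (simp add: \<theta>_def)
  next
    have "\<bar>of_int n - (u - \<theta>) / (2 * pi)\<bar> \<le> 1 / 2"
      unfolding n_def by (rule of_int_round_abs_le)
    then have "(2 * pi) * \<bar>of_int n - (u - \<theta>) / (2 * pi)\<bar> \<le> (2 * pi) * (1 / 2)"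
      by (intro mult_left_mono) auto
    also have "(2 * pi) * \<bar>of_int n - (u - \<theta>) / (2 * pi)\<bar> = \<bar>2 * pi * of_int n - (u - \<theta>)\<bar>"
    proof -
      have "(2 * pi) * (of_int n - (u - \<theta>) / (2 * pi)) = 2 * pi * of_int n - (u - \<theta>)"
        by (simp add: field_simps)
      then show ?thesis by (metis abs_mult abs_of_pos pi_gt_zero mult_pos_pos zero_less_numeral)
    qed
    finally show "\<bar>u - (\<theta> + 2 * pi * of_int n)\<bar> \<le> pi" by simp
  qed
qed

lemma cos_mono_towards_0:
  fixes v t :: real
  assumes "\<bar>v\<bar> \<le> pi" "0 \<le> t" "t \<le> 1"
  shows "cos v \<le> cos (t * v)"
proof -
  have "t * \<bar>v\<bar> \<le> \<bar>v\<bar>" using assms by (simp add: mult_left_le_one_le)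
  then have "cos \<bar>v\<bar> \<le> cos (t * \<bar>v\<bar>)"
    using assms by (intro cos_monotone_0_pi_le) auto
  also have "t * \<bar>v\<bar> = \<bar>t * v\<bar>" using assms by (simp add: abs_mult)
  finally show ?thesis by simp
qed

text \<open>Call a point a peak if every summand is maximal there. Moving each coordinate straight to its
  nearest maximum does not decrease any summand, so each point of the positivity set is joined to a peak
  inside the set. Two peaks are joined by changing one coordinate at a time: while coordinate \<open>j\<close>
  moves, all other summands stay maximal, and by assumption they outweigh the \<open>j\<close>-th one.\<close>

lemma connected_positive_cosine_sum:
  fixes a :: "'n::finite \<Rightarrow> real"
  assumes dom: "\<And>i. \<bar>a i\<bar> < (\<Sum>j\<in>UNIV - {i}. \<bar>a j\<bar>)"
  shows "connected {u :: real ^ 'n. 0 < (\<Sum>i\<in>UNIV. a i * cos (u $ i))}" (is "connected ?S")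
    and "{u :: real ^ 'n. 0 < (\<Sum>i\<in>UNIV. a i * cos (u $ i))} \<noteq> {}"
proof -
  define P where "P = {q :: real ^ 'n. \<forall>i x. a i * cos x = \<bar>a i\<bar> * cos (x - q $ i)}"
  have peak: "a i * cos (q $ i) = \<bar>a i\<bar>" if "q \<in> P" for q i
    using that unfolding P_def by (metis (mono_tags, lifting) cos_zero diff_self mem_Collect_eq mult.right_neutral)
  have near: "\<exists>q\<in>P. \<forall>i. \<bar>u $ i - q $ i\<bar> \<le> pi" for u
  proof -
    have "\<forall>i. \<exists>q. (\<forall>x. a i * cos x = \<bar>a i\<bar> * cos (x - q)) \<and> \<bar>u $ i - q\<bar> \<le> pi"
      by (meson nearest_peak)
    then obtain q where "\<forall>i. (\<forall>x. a i * cos x = \<bar>a i\<bar> * cos (x - q i)) \<and> \<bar>u $ i - q i\<bar> \<le> pi"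
      by metis
    then show ?thesis by (intro bexI[of _ "\<chi> i. q i"]) (auto simp: P_def)
  qed
  have to_peak: "connected_component ?S u q"
    if u: "u \<in> ?S" and q: "q \<in> P" "\<And>i. \<bar>u $ i - q $ i\<bar> \<le> pi" for u q
  proof (rule connected_componentI[of "closed_segment u q"])
    show "closed_segment u q \<subseteq> ?S"
    proof
      fix z assume "z \<in> closed_segment u q"
      then obtain t where t: "0 \<le> t" "t \<le> 1" "z = (1 - t) *\<^sub>R u + t *\<^sub>R q"
        by (auto simp: in_segment)
      have "a i * cos (u $ i) \<le> a i * cos (z $ i)" for i
      proof -
        have cos_eq: "a i * cos x = \<bar>a i\<bar> * cos (x - q $ i)" for x
          using q(1) by (simp add: P_def)
        have "z $ i - q $ i = (1 - t) * (u $ i - q $ i)"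
          by (simp add: t(3) algebra_simps)
        then have "cos (u $ i - q $ i) \<le> cos (z $ i - q $ i)"
          using cos_mono_towards_0[OF q(2)[of i], of "1 - t"] t by simp
        then show ?thesis
          unfolding cos_eq[of "u $ i"] cos_eq[of "z $ i"] by (intro mult_left_mono) auto
      qed
      then have "(\<Sum>i\<in>UNIV. a i * cos (u $ i)) \<le> (\<Sum>i\<in>UNIV. a i * cos (z $ i))"
        by (intro sum_mono)
      with u show "z \<in> ?S" by simp
    qed
  qed auto
  have one_coordinate: "z \<in> ?S" if q: "q \<in> P" and z: "\<And>i. i \<noteq> j \<Longrightarrow> z $ i = q $ i" for z q j
  proof -
    have "- \<bar>a j\<bar> \<le> a j * cos (z $ j)"
    proof -
      have "\<bar>a j * cos (z $ j)\<bar> \<le> \<bar>a j\<bar> * 1"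
        unfolding abs_mult by (intro mult_left_mono) auto
      then show ?thesis by simp
    qed
    moreover have "(\<Sum>i\<in>UNIV - {j}. a i * cos (z $ i)) = (\<Sum>i\<in>UNIV - {j}. \<bar>a i\<bar>)"
      by (intro sum.cong) (auto simp: z peak[OF q])
    ultimately show ?thesis
      using dom[of j] by (simp add: sum.remove[of UNIV j])
  qed
  have peaks: "connected_component ?S p q" if "p \<in> P" "q \<in> P" for p q
  proof -
    define m where "m J = (\<chi> i. if i \<in> J then q $ i else p $ i)" for J
    have mP: "m J \<in> P" for J using that by (auto simp: P_def m_def)
    have "connected_component ?S p (m J)" for J
    proof (induction J rule: finite_induct[OF finite])
      case 1
      have "m {} = p" by (simp add: m_def vec_eq_iff)
      then show ?case using one_coordinate[OF that(1)] by simp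
    next
      case (2 j J)
      have "connected_component ?S (m J) (m (insert j J))"
      proof (rule connected_componentI[of "closed_segment (m J) (m (insert j J))"])
        show "closed_segment (m J) (m (insert j J)) \<subseteq> ?S"
        proof
          fix z assume "z \<in> closed_segment (m J) (m (insert j J))"
          then obtain t where "z = (1 - t) *\<^sub>R m J + t *\<^sub>R m (insert j J)"
            by (auto simp: in_segment)
          then have "z $ i = m J $ i" if "i \<noteq> j" for i
          proof -
            have "m (insert j J) $ i = m J $ i" using that by (simp add: m_def)
            then show ?thesis
              by (simp add: \<open>z = (1 - t) *\<^sub>R m J + t *\<^sub>R m (insert j J)\<close> algebra_simps)
          qed
          then show "z \<in> ?S" by (rule one_coordinate[OF mP])
        qed
      qed auto
      with 2 show ?case by (meson connected_component_trans)
    qed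
    from this[of UNIV] show ?thesis by (simp add: m_def vec_lambda_eta)
  qed
  show "connected ?S"
    unfolding connected_iff_connected_component
  proof (intro ballI)
    fix u v assume uv: "u \<in> ?S" "v \<in> ?S"
    obtain p q where p: "p \<in> P" "\<And>i. \<bar>u $ i - p $ i\<bar> \<le> pi" and q: "q \<in> P" "\<And>i. \<bar>v $ i - q $ i\<bar> \<le> pi"
      using near by metis
    have "connected_component ?S u p" "connected_component ?S p q" "connected_component ?S q v"
      using to_peak[OF uv(1) p] peaks[OF p(1) q(1)] to_peak[OF uv(2) q]
      by (auto intro: connected_component_sym)
    then show "connected_component ?S u v" by (meson connected_component_trans)
  qed
  show "?S \<noteq> {}"
    using near one_coordinate by blast
qed

text \<open>For invertible \<open>A\<close> the phases are coordinates in which the previous lemma applies.\<close>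

lemma connected_positive_wave_sum:
  fixes A :: "real ^ 'n::finite ^ 'n" and a c :: "'n \<Rightarrow> real"
  assumes "det A \<noteq> 0" and "\<And>i. \<bar>a i\<bar> < (\<Sum>j\<in>UNIV - {i}. \<bar>a j\<bar>)"
  shows "connected {x. 0 < (\<Sum>i\<in>UNIV. a i * cos ((A *v x) $ i + c i))}" (is "connected ?T")
    and "{x. 0 < (\<Sum>i\<in>UNIV. a i * cos ((A *v x) $ i + c i))} \<noteq> {}"
proof -
  let ?S = "{u :: real ^ 'n. 0 < (\<Sum>i\<in>UNIV. a i * cos (u $ i))}"
  let ?c = "\<chi> i. c i"
  obtain B where "A ** B = mat 1" "B ** A = mat 1"
    using assms(1) by (auto simp: invertible_det_nz[symmetric] invertible_def)
  then have r: "A *v (B *v y) = y" and l: "B *v (A *v y) = y" for y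
    by (simp_all add: matrix_vector_mul_assoc)
  let ?h = "\<lambda>u. B *v (u - ?c)"
  have T: "?T = ?h ` ?S"
  proof (intro set_eqI iffI)
    fix x assume "x \<in> ?T"
    then have "A *v x + ?c \<in> ?S" by simp
    moreover have "x = ?h (A *v x + ?c)" by (simp add: l)
    ultimately show "x \<in> ?h ` ?S" by blast
  next
    fix x assume "x \<in> ?h ` ?S"
    then obtain u where "u \<in> ?S" "x = ?h u" by blast
    then show "x \<in> ?T" by (simp add: r)
  qed
  have "continuous_on ?S ?h"
    by (rule linear_continuous_on_compose[OF _ matrix_vector_mul_linear]) (intro continuous_intros)
  with connected_positive_cosine_sum(1)[OF assms(2)] show "connected ?T"
    unfolding T by (intro connected_continuous_image)
  show "?T \<noteq> {}"
    unfolding T using connected_positive_cosine_sum(2)[OF assms(2)] by blast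
qed

section \<open>Nodal domains\<close>

lemma card_nodal_domains_eq_2:
  fixes g :: "'a::topological_space \<Rightarrow> real"
  assumes cont: "continuous_on UNIV g"
    and pos: "connected {x. 0 < g x}" "{x. 0 < g x} \<noteq> {}"
    and neg: "connected {x. g x < 0}" "{x. g x < 0} \<noteq> {}"
  shows "card (nodal_domains (\<lambda>x. complex_of_real (g x))) = 2"
proof -
  let ?P = "{x. 0 < g x}" and ?N = "{x. g x < 0}"
  have "open ?P" "open ?N"
    using cont by (auto intro: open_Collect_less continuous_on_const)
  have D: "{x. complex_of_real (g x) \<noteq> 0} = ?P \<union> ?N" by auto
  have sides: "C \<subseteq> ?P \<or> C \<subseteq> ?N" if "connected C" "C \<subseteq> ?P \<union> ?N" for C
  proof (rule ccontr)
    assume "\<not> ?thesis"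
    then have "?P \<inter> C \<noteq> {}" "?N \<inter> C \<noteq> {}" using that(2) by blast+
    moreover have "?P \<inter> ?N \<inter> C = {}" by auto
    ultimately show False
      using connectedD[OF that(1) \<open>open ?P\<close> \<open>open ?N\<close>] that(2) by blast
  qed
  have "components (?P \<union> ?N) = {?P, ?N}"
  proof (intro set_eqI iffI)
    fix C assume C: "C \<in> components (?P \<union> ?N)"
    then have C': "connected C" "C \<subseteq> ?P \<union> ?N" "C \<noteq> {}"
      by (auto intro: in_components_connected dest: in_components_subset in_components_nonempty)
    have max: "C = D" if "connected D" "D \<subseteq> ?P \<union> ?N" "C \<subseteq> D" for D
      using components_maximal[OF C that(1,2)] that(3) C'(3) by blast
    show "C \<in> {?P, ?N}"
      using sides[OF C'(1,2)] max[OF pos(1)] max[OF neg(1)] by auto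
  next
    have comp: "X \<in> components (?P \<union> ?N)"
      if X: "X \<noteq> {}" "connected X" "X \<subseteq> ?P \<union> ?N"
        and max: "\<And>Y. connected Y \<Longrightarrow> Y \<subseteq> ?P \<union> ?N \<Longrightarrow> X \<subseteq> Y \<Longrightarrow> Y = X" for X
      using X max unfolding in_components_maximal by auto
    fix C assume "C \<in> {?P, ?N}"
    then consider "C = ?P" | "C = ?N" by blast
    then show "C \<in> components (?P \<union> ?N)"
    proof cases
      case 1
      show ?thesis unfolding 1
      proof (rule comp)
        fix Y assume Y: "connected Y" "Y \<subseteq> ?P \<union> ?N" "?P \<subseteq> Y"
        have "\<not> Y \<subseteq> ?N" using Y(3) pos(2) by force
        with sides[OF Y(1,2)] Y(3) show "Y = ?P" by blast
      qed (use pos in auto)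
    next
      case 2
      show ?thesis unfolding 2
      proof (rule comp)
        fix Y assume Y: "connected Y" "Y \<subseteq> ?P \<union> ?N" "?N \<subseteq> Y"
        have "\<not> Y \<subseteq> ?P" using Y(3) neg(2) by force
        with sides[OF Y(1,2)] Y(3) show "Y = ?N" by blast
      qed (use neg in auto)
    qed
  qed
  moreover have "?P \<noteq> ?N" using pos(2) by force
  ultimately show ?thesis
    unfolding nodal_domains_def D by simp
qed

section \<open>Smoothness and the Laplacian\<close>

text \<open>Writing the derivative of the cosine as a cosine with shifted phase keeps the partial derivatives in
  the same family of functions, so smoothness follows by induction and the Laplacian by two
  applications of this lemma.\<close>

lemma partial_deriv_cosine_sum:
  "partial_deriv i (\<lambda>x. complex_of_real (\<Sum>j\<in>J. c j * cos (angle (l j) x + \<phi> j))) =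
    (\<lambda>x. complex_of_real (\<Sum>j\<in>J. (2 * pi * of_int (l j $ i) * c j) * cos (angle (l j) x + (\<phi> j + pi / 2))))"
proof
  fix x
  have line: "angle k (x + t *\<^sub>R axis i 1) = angle k x + t * (2 * pi * of_int (k $ i))" for k t
  proof -
    have "of_int (k $ j) * (x + t *\<^sub>R axis i 1) $ j =
        of_int (k $ j) * x $ j + (if j = i then of_int (k $ i) * t else 0)" for j
      by (simp add: axis_def algebra_simps)
    then show ?thesis by (simp add: angle_def sum.distrib algebra_simps)
  qed
  have "((\<lambda>t. \<Sum>j\<in>J. c j * cos (angle (l j) x + t * (2 * pi * of_int (l j $ i)) + \<phi> j)) has_real_derivative
      (\<Sum>j\<in>J. (2 * pi * of_int (l j $ i) * c j) * cos (angle (l j) x + (\<phi> j + pi / 2)))) (at 0)"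
    by (auto intro!: derivative_eq_intros sum.cong simp: cos_add sin_add algebra_simps)
  then have "((\<lambda>t. complex_of_real (\<Sum>j\<in>J. c j * cos (angle (l j) x + t * (2 * pi * of_int (l j $ i)) + \<phi> j)))
      has_vector_derivative
      of_real (\<Sum>j\<in>J. (2 * pi * of_int (l j $ i) * c j) * cos (angle (l j) x + (\<phi> j + pi / 2)))) (at 0)"
    by (intro has_vector_derivative_of_real)
  then show "partial_deriv i (\<lambda>x. complex_of_real (\<Sum>j\<in>J. c j * cos (angle (l j) x + \<phi> j))) x =
      of_real (\<Sum>j\<in>J. (2 * pi * of_int (l j $ i) * c j) * cos (angle (l j) x + (\<phi> j + pi / 2)))"
    unfolding partial_deriv_def line by (rule vector_derivative_at)
qed

lemma linear_angle: "linear (angle k)"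
  by (rule linearI) (simp_all add: angle_def sum.distrib sum_distrib_left algebra_simps)

lemma C_k_cosine_sum:
  "C_k n (\<lambda>x. complex_of_real (\<Sum>j\<in>J. c j * cos (angle (l j) x + \<phi> j)))"
proof (induction n arbitrary: c \<phi>)
  case 0
  show ?case by (auto intro!: continuous_intros)
next
  case (Suc n)
  have "(angle k has_derivative angle k) (at x)" for k x
    by (intro bounded_linear_imp_has_derivative)
      (simp add: linear_conv_bounded_linear[symmetric] linear_angle)
  note [derivative_intros] = this
  have "((\<lambda>x. complex_of_real (\<Sum>j\<in>J. c j * cos (angle (l j) x + \<phi> j))) has_derivative
      (\<lambda>y. of_real (\<Sum>j\<in>J. c j * (- sin (angle (l j) x + \<phi> j) * angle (l j) y)))) (at x)" for x
    by (auto intro!: derivative_eq_intros sum.cong simp: algebra_simps)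
  then have "(\<lambda>x. complex_of_real (\<Sum>j\<in>J. c j * cos (angle (l j) x + \<phi> j))) differentiable (at x)" for x
    unfolding differentiable_def by blast
  then show ?case
    unfolding C_k.simps partial_deriv_cosine_sum by (intro conjI allI Suc.IH)
qed

definition freq_sq :: "int ^ 3 \<Rightarrow> int" where
  "freq_sq k = (\<Sum>i\<in>UNIV. (k $ i)\<^sup>2)"

lemma laplacian_cosine_sum:
  assumes "\<And>j. j \<in> J \<Longrightarrow> freq_sq (l j) = N"
  shows "laplacian (\<lambda>x. complex_of_real (\<Sum>j\<in>J. c j * cos (angle (l j) x + \<phi> j))) x =
    of_real (- (2 * pi)\<^sup>2 * of_int N) * of_real (\<Sum>j\<in>J. c j * cos (angle (l j) x + \<phi> j))"
proof -
  let ?w = "\<lambda>j. c j * cos (angle (l j) x + \<phi> j)"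
  have "laplacian (\<lambda>x. complex_of_real (\<Sum>j\<in>J. c j * cos (angle (l j) x + \<phi> j))) x =
      of_real (\<Sum>i\<in>UNIV. \<Sum>j\<in>J. - (2 * pi)\<^sup>2 * of_int ((l j $ i)\<^sup>2) * ?w j)"
    unfolding laplacian_def partial_deriv_cosine_sum of_real_sum[symmetric]
    by (intro arg_cong[of _ _ complex_of_real] sum.cong)
      (auto simp: cos_add sin_add power2_eq_square algebra_simps)
  also have "(\<Sum>i\<in>UNIV. \<Sum>j\<in>J. - (2 * pi)\<^sup>2 * of_int ((l j $ i)\<^sup>2) * ?w j) =
      (\<Sum>j\<in>J. - (2 * pi)\<^sup>2 * of_int (freq_sq (l j)) * ?w j)"
    by (subst sum.swap) (simp add: freq_sq_def sum_distrib_left sum_distrib_right sum_negf algebra_simps)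
  also have "\<dots> = - (2 * pi)\<^sup>2 * of_int N * (\<Sum>j\<in>J. ?w j)"
    using assms by (simp add: sum_distrib_left)
  finally show ?thesis by simp
qed

lemma laplace_eigenfunction_plane_wave_sum:
  assumes "\<And>j. j \<in> J \<Longrightarrow> freq_sq (l j) = N"
    and "\<exists>p. (\<Sum>j\<in>J. c j * plane_wave (l j) (\<phi> j) p) \<noteq> 0"
  shows "laplace_eigenfunction (\<lambda>p. complex_of_real (\<Sum>j\<in>J. c j * plane_wave (l j) (\<phi> j) p))"
proof -
  let ?f = "\<lambda>p. complex_of_real (\<Sum>j\<in>J. c j * plane_wave (l j) (\<phi> j) p)"
  have lift: "?f \<circ> torus3_proj = (\<lambda>x. complex_of_real (\<Sum>j\<in>J. c j * cos (angle (l j) x + \<phi> j)))"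
    by (simp add: o_def)
  have "laplacian (?f \<circ> torus3_proj) x = of_real (- (2 * pi)\<^sup>2 * of_int N) * ?f (torus3_proj x)" for x
    unfolding lift plane_wave_proj by (rule laplacian_cosine_sum[OF assms(1)])
  moreover have "C_k n (?f \<circ> torus3_proj)" for n
    unfolding lift by (rule C_k_cosine_sum)
  ultimately show ?thesis
    unfolding laplace_eigenfunction_def using assms(2) by (metis of_real_eq_0_iff)
qed

section \<open>Frequency blocks\<close>

text \<open>A partition of the nonzero frequencies, taken up to sign, into blocks of vectors of equal length,
  such that any three members of a block are linearly independent. Frequencies with nonzero
  coordinates are grouped by the absolute values of the coordinates; the listed representatives are
  those whose coordinates have positive product. The vectors with exactly one zero coordinate whose
  nonzero ones are \<open>\<plusminus>a\<close> and \<open>\<plusminus>b\<close>, in an order fixed up to rotation, give six frequencies and are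
  divided between \<open>planar\<close> and \<open>planar'\<close>. The division has to avoid triples such as
  \<open>(a,-b,0), (0,a,-b), (-b,0,a)\<close>, which are dependent for \<open>a = b\<close>.\<close>

inductive_set freq_blocks :: "(int ^ 3) list set" where
  octant: "0 < a \<Longrightarrow> 0 < b \<Longrightarrow> 0 < c \<Longrightarrow>
    [vector [a, b, c], vector [a, - b, - c], vector [- a, b, - c], vector [- a, - b, c]] \<in> freq_blocks"
| planar: "0 < a \<Longrightarrow> 0 < b \<Longrightarrow>
    [vector [a, b, 0], vector [a, - b, 0], vector [b, 0, a]] \<in> freq_blocks"
| planar': "0 < a \<Longrightarrow> 0 < b \<Longrightarrow>
    [vector [0, a, b], vector [0, a, - b], vector [- b, 0, a]] \<in> freq_blocks"
| axial: "0 < a \<Longrightarrow>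
    [vector [a, 0, 0], vector [0, a, 0], vector [0, 0, a]] \<in> freq_blocks"

lemma length_freq_block: "bs \<in> freq_blocks \<Longrightarrow> length bs = 3 \<or> length bs = 4"
  by (induction rule: freq_blocks.induct) auto

lemma freq_sq_block:
  assumes "bs \<in> freq_blocks" and "j < length bs"
  shows "freq_sq (bs ! j) = freq_sq (bs ! 0)"
proof -
  have "\<forall>j<length bs. freq_sq (bs ! j) = freq_sq (bs ! 0)"
    using assms(1)
    by (induction rule: freq_blocks.induct) (simp_all add: All_less_Suc freq_sq_def sum_3)
  with assms(2) show ?thesis by blast
qed

lemma vector_3_eq_iff:
  "vector [a, b, c] = (vector [a', b', c'] :: int ^ 3) \<longleftrightarrow> a = a' \<and> b = b' \<and> c = c'"
  by (auto simp: vec_eq_iff forall_3)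

lemma vector_3_uminus: "- vector [a, b, c] = (vector [- a, - b, - c] :: int ^ 3)"
  by (simp add: vec_eq_iff forall_3)

text \<open>No frequency occurs twice, even up to sign: this is what makes plane waves from different blocks,
  or from different positions in a block, orthogonal.\<close>

lemma freq_blocks_disjoint:
  assumes "bs \<in> freq_blocks" "cs \<in> freq_blocks" "i < length bs" "j < length cs"
  shows "bs ! i \<noteq> - cs ! j" and "bs ! i = cs ! j \<longleftrightarrow> bs = cs \<and> i = j"
proof -
  have "\<forall>i<length bs. \<forall>j<length cs. bs ! i \<noteq> - cs ! j \<and> (bs ! i = cs ! j \<longrightarrow> bs = cs \<and> i = j)"
    by (rule freq_blocks.cases[OF assms(1)]; rule freq_blocks.cases[OF assms(2)])
      (simp_all add: All_less_Suc vector_3_eq_iff vector_3_uminus)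
  with assms(3,4) show "bs ! i \<noteq> - cs ! j" and "bs ! i = cs ! j \<longleftrightarrow> bs = cs \<and> i = j" by auto
qed

lemma freq_blocks_cover:
  assumes "k \<noteq> 0"
  shows "\<exists>bs\<in>freq_blocks. \<exists>j<length bs. k = bs ! j \<or> k = - bs ! j"
proof -
  define cov where "cov k \<longleftrightarrow> (\<exists>bs\<in>freq_blocks. \<exists>j<length bs. k = bs ! j \<or> k = - bs ! j)" for k
  have nth: "cov (bs ! j)" if "bs \<in> freq_blocks" "j < length bs" for bs j
    using that unfolding cov_def by blast
  have cov_uminus: "cov k" if "cov (- k)" for k
    using that unfolding cov_def by (metis minus_minus)
  have octant: "cov (vector [a, b, c])" "cov (vector [a, - b, - c])"
      "cov (vector [- a, b, - c])" "cov (vector [- a, - b, c])"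
    if "0 < a" "0 < b" "0 < c" for a b c
    using nth[OF freq_blocks.octant[OF that], of 0] nth[OF freq_blocks.octant[OF that], of 1]
      nth[OF freq_blocks.octant[OF that], of 2] nth[OF freq_blocks.octant[OF that], of 3]
    by simp_all
  have planar: "cov (vector [a, b, 0])" "cov (vector [a, - b, 0])" "cov (vector [b, 0, a])"
      "cov (vector [0, a, b])" "cov (vector [0, a, - b])" "cov (vector [- b, 0, a])"
    if "0 < a" "0 < b" for a b
    using nth[OF freq_blocks.planar[OF that], of 0] nth[OF freq_blocks.planar[OF that], of 1]
      nth[OF freq_blocks.planar[OF that], of 2] nth[OF freq_blocks.planar'[OF that], of 0]
      nth[OF freq_blocks.planar'[OF that], of 1] nth[OF freq_blocks.planar'[OF that], of 2]
    by simp_all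
  have axial: "cov (vector [a, 0, 0])" "cov (vector [0, a, 0])" "cov (vector [0, 0, a])"
    if "0 < a" for a
    using nth[OF freq_blocks.axial[OF that], of 0] nth[OF freq_blocks.axial[OF that], of 1]
      nth[OF freq_blocks.axial[OF that], of 2]
    by simp_all
  \<comment> \<open>One representative of each pair \<open>\<plusminus>k\<close>, according to the signs of the coordinates.\<close>
  define pos where "pos x y z \<longleftrightarrow>
      (0 < x \<and> 0 < y \<and> 0 < z) \<or> (0 < x \<and> y < 0 \<and> z < 0) \<or> (x < 0 \<and> 0 < y \<and> z < 0) \<or> (x < 0 \<and> y < 0 \<and> 0 < z) \<or>
      (0 < x \<and> 0 < y \<and> z = 0) \<or> (0 < x \<and> y < 0 \<and> z = 0) \<or>
      (x = 0 \<and> 0 < y \<and> 0 < z) \<or> (x = 0 \<and> 0 < y \<and> z < 0) \<or>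
      (0 < x \<and> y = 0 \<and> 0 < z) \<or> (x < 0 \<and> y = 0 \<and> 0 < z) \<or>
      (0 < x \<and> y = 0 \<and> z = 0) \<or> (x = 0 \<and> 0 < y \<and> z = 0) \<or> (x = 0 \<and> y = 0 \<and> 0 < z)"
    for x y z :: int
  have cov_pos: "cov (vector [x, y, z])" if "pos x y z" for x y z
    using that unfolding pos_def
    by (elim disjE conjE)
      (use octant[of x y z] octant[of x "- y" "- z"] octant[of "- x" y "- z"] octant[of "- x" "- y" z]
        planar[of x y] planar[of x "- y"] planar[of y z] planar[of y "- z"] planar[of z x]
        planar[of z "- x"] axial[of x] axial[of y] axial[of z] in simp_all)
  have k: "k = vector [k $ 1, k $ 2, k $ 3]"
    by (simp add: vec_eq_iff forall_3)
  have "k $ 1 \<noteq> 0 \<or> k $ 2 \<noteq> 0 \<or> k $ 3 \<noteq> 0"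
    using assms by (auto simp: vec_eq_iff forall_3)
  then have "pos (k $ 1) (k $ 2) (k $ 3) \<or> pos (- (k $ 1)) (- (k $ 2)) (- (k $ 3))"
    unfolding pos_def
    by (cases "k $ 1" "0 :: int" rule: linorder_cases; cases "k $ 2" "0 :: int" rule: linorder_cases;
        cases "k $ 3" "0 :: int" rule: linorder_cases) simp_all
  then have "cov k"
  proof
    assume "pos (k $ 1) (k $ 2) (k $ 3)"
    then show ?thesis by (subst k) (rule cov_pos)
  next
    assume "pos (- (k $ 1)) (- (k $ 2)) (- (k $ 3))"
    then have "cov (- vector [k $ 1, k $ 2, k $ 3])"
      unfolding vector_3_uminus by (rule cov_pos)
    then show ?thesis using cov_uminus k by metis
  qed
  then show ?thesis by (simp add: cov_def)
qed

text \<open>For blocks of length 3 this is \<open>2/3 J - I\<close>, where \<open>J\<close> is the all-ones matrix; for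
  blocks of length 4 it is the normalized skew conference matrix. Both are orthogonal, and the
  nonzero entries of a row are exactly three numbers whose absolute values are the sides of a
  nondegenerate triangle: \<open>1/3, 2/3, 2/3\<close> and \<open>1/\<surd>3, 1/\<surd>3, 1/\<surd>3\<close>.\<close>

definition mixing :: "nat \<Rightarrow> nat \<Rightarrow> nat \<Rightarrow> real" where
  "mixing n i j = (if n = 3 then if i = j then - 1 / 3 else 2 / 3
     else [[0, 1, 1, 1], [- 1, 0, 1, - 1], [- 1, - 1, 0, 1], [- 1, 1, - 1, 0]] ! i ! j / sqrt 3)"

lemma sum_lessThan_3: "(\<Sum>j<3::nat. f j) = f 0 + f 1 + f 2"
  and sum_lessThan_4: "(\<Sum>j<4::nat. f j) = f 0 + f 1 + f 2 + f 3"
  by (simp_all add: eval_nat_numeral)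

lemma all_less_3: "(\<forall>i<3::nat. P i) \<longleftrightarrow> P 0 \<and> P 1 \<and> P 2"
  and all_less_4: "(\<forall>i<4::nat. P i) \<longleftrightarrow> P 0 \<and> P 1 \<and> P 2 \<and> P 3"
  by (auto simp: All_less_Suc eval_nat_numeral)

lemma mixing_rows:
  assumes "n = 3 \<or> n = 4" "i < n" "i' < n"
  shows "(\<Sum>j<n. mixing n i j * mixing n i' j) = (if i = i' then 1 else 0)"
proof -
  have "\<forall>i<n. \<forall>i'<n. (\<Sum>j<n. mixing n i j * mixing n i' j) = (if i = i' then 1 else 0)"
    using assms(1)
    by (elim disjE) (simp_all add: all_less_3 all_less_4 sum_lessThan_3 sum_lessThan_4 mixing_def)
  with assms show ?thesis by blast
qed

lemma mixing_columns:
  assumes "n = 3 \<or> n = 4" "j < n" "j' < n"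
  shows "(\<Sum>i<n. mixing n i j * mixing n i j') = (if j = j' then 1 else 0)"
proof -
  have "\<forall>j<n. \<forall>j'<n. (\<Sum>i<n. mixing n i j * mixing n i j') = (if j = j' then 1 else 0)"
    using assms(1)
    by (elim disjE) (simp_all add: all_less_3 all_less_4 sum_lessThan_3 sum_lessThan_4 mixing_def)
  with assms show ?thesis by blast
qed

text \<open>For linearly independent frequencies the three phases are coordinates on \<open>\<real>\<^sup>3\<close>. Connectedness
  already holds there, before passing to the torus; this is what excludes the parallel slabs that the
  separate cosines produce.\<close>

lemma three_independent_cosines:
  fixes l :: "3 \<Rightarrow> int ^ 3"
  assumes "det (\<chi> m. l m) \<noteq> 0"
    and "\<And>m. \<bar>a m\<bar> < (\<Sum>j\<in>UNIV - {m}. \<bar>a j\<bar>)"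
  shows "connected {x. 0 < (\<Sum>m\<in>UNIV. a m * cos (angle (l m) x + \<phi>))}"
    and "{x. 0 < (\<Sum>m\<in>UNIV. a m * cos (angle (l m) x + \<phi>))} \<noteq> {}"
proof -
  define A :: "real ^ 3 ^ 3" where "A = (\<chi> m i. 2 * pi * of_int (l m $ i))"
  have "det A = (2 * pi) ^ 3 * of_int (det (\<chi> m. l m))"
    by (simp add: det_3 A_def power3_eq_cube algebra_simps)
  then have "det A \<noteq> 0" using assms(1) by simp
  moreover have "(A *v x) $ m = angle (l m) x" for x m
    by (simp add: A_def matrix_vector_mult_def angle_def sum_distrib_left mult.assoc)
  ultimately show "connected {x. 0 < (\<Sum>m\<in>UNIV. a m * cos (angle (l m) x + \<phi>))}"
    and "{x. 0 < (\<Sum>m\<in>UNIV. a m * cos (angle (l m) x + \<phi>))} \<noteq> {}"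
    using connected_positive_wave_sum[of A a "\<lambda>_. \<phi>"] assms(2) by simp_all
qed

lemma det_3_int: "det (vector [vector [a, b, c], vector [d, e, f], vector [g, h, i]] :: int ^ 3 ^ 3) =
    a * (e * i - f * h) - b * (d * i - f * g) + c * (d * h - e * g)"
  by (simp add: det_3 algebra_simps)

text \<open>In a block of length 4 the row \<open>i\<close> of the matrix vanishes at position \<open>i\<close>, and the remaining three
  frequencies are independent like any three of the four.\<close>

lemma block_row_three_frequencies:
  assumes "bs \<in> freq_blocks" and "i < length bs"
  shows "\<exists>(l :: 3 \<Rightarrow> int ^ 3) a. det (\<chi> m. l m) \<noteq> 0 \<and> (\<forall>m. \<bar>a m\<bar> < (\<Sum>j\<in>UNIV - {m}. \<bar>a j\<bar>)) \<and>
    (\<forall>h. (\<Sum>j<length bs. mixing (length bs) i j * h (bs ! j)) = (\<Sum>m\<in>UNIV. a m * h (l m)))"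
    (is "\<exists>l a. ?P l a")
proof -
  let ?n = "length bs"
  let ?M = "mixing ?n i"
  have intro: ?thesis
    if "det (vector [bs ! u, bs ! v, bs ! w] :: int ^ 3 ^ 3) \<noteq> 0"
      and "\<bar>?M u\<bar> < \<bar>?M v\<bar> + \<bar>?M w\<bar>" "\<bar>?M v\<bar> < \<bar>?M u\<bar> + \<bar>?M w\<bar>" "\<bar>?M w\<bar> < \<bar>?M u\<bar> + \<bar>?M v\<bar>"
      and "\<And>h. (\<Sum>j<?n. ?M j * h (bs ! j)) = ?M u * h (bs ! u) + ?M v * h (bs ! v) + ?M w * h (bs ! w)"
    for u v w
  proof -
    define l where "l m = (vector [bs ! u, bs ! v, bs ! w] :: int ^ 3 ^ 3) $ m" for m
    define a where "a m = (vector [?M u, ?M v, ?M w] :: real ^ 3) $ m" for m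
    have "(\<chi> m. l m) = vector [bs ! u, bs ! v, bs ! w]" by (simp add: l_def vec_eq_iff)
    moreover have "(\<Sum>j\<in>UNIV - {m}. \<bar>a j\<bar>) = \<bar>a 1\<bar> + \<bar>a 2\<bar> + \<bar>a 3\<bar> - \<bar>a m\<bar>" for m
      by (subst sum_diff1) (simp_all add: sum_3)
    ultimately have "?P l a"
      using that by (simp add: forall_3 sum_3) (simp add: a_def l_def)
    then show ?thesis by blast
  qed
  show ?thesis
  proof (cases "?n = 3")
    case True
    show ?thesis
    proof (rule intro)
      show "det (vector [bs ! 0, bs ! 1, bs ! 2] :: int ^ 3 ^ 3) \<noteq> 0"
        using assms(1) True
        by (cases rule: freq_blocks.cases) (simp_all add: det_3_int)
      have "i = 0 \<or> i = 1 \<or> i = 2" using assms(2) True by auto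
      then show "\<bar>?M 0\<bar> < \<bar>?M 1\<bar> + \<bar>?M 2\<bar>" "\<bar>?M 1\<bar> < \<bar>?M 0\<bar> + \<bar>?M 2\<bar>" "\<bar>?M 2\<bar> < \<bar>?M 0\<bar> + \<bar>?M 1\<bar>"
        by (auto simp: mixing_def True)
    qed (simp add: True sum_lessThan_3)
  next
    case False
    then have n: "?n = 4" using length_freq_block[OF assms(1)] by simp
    obtain a b c where bs: "0 < a" "0 < b" "0 < c"
      "bs = [vector [a, b, c], vector [a, - b, - c], vector [- a, b, - c], vector [- a, - b, c]]"
      using assms(1) n by (cases rule: freq_blocks.cases) auto
    have "i = 0 \<or> i = 1 \<or> i = 2 \<or> i = 3" using assms(2) n by auto
    then show ?thesis
    proof (elim disjE)
      assume i: "i = 0"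
      show ?thesis
        by (rule intro[of 1 2 3]) (use bs(1-3) in \<open>simp_all add: n sum_lessThan_4 i mixing_def bs(4) det_3_int divide_strict_right_mono\<close>)
    next
      assume i: "i = 1"
      show ?thesis
        by (rule intro[of 0 2 3]) (use bs(1-3) in \<open>simp_all add: n sum_lessThan_4 i mixing_def bs(4) det_3_int divide_strict_right_mono\<close>)
    next
      assume i: "i = 2"
      show ?thesis
        by (rule intro[of 0 1 3]) (use bs(1-3) in \<open>simp_all add: n sum_lessThan_4 i mixing_def bs(4) det_3_int divide_strict_right_mono\<close>)
    next
      assume i: "i = 3"
      show ?thesis
        by (rule intro[of 0 1 2]) (use bs(1-3) in \<open>simp_all add: n sum_lessThan_4 i mixing_def bs(4) det_3_int divide_strict_right_mono\<close>)
    qed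
  qed
qed

section \<open>The basis functions\<close>

text \<open>The factor \<open>\<surd>2\<close> normalizes, because \<open>cos\<^sup>2\<close> has mean \<open>1 / 2\<close>.\<close>

definition block_wave :: "(int ^ 3) list \<Rightarrow> nat \<Rightarrow> real \<Rightarrow> torus3 \<Rightarrow> real" where
  "block_wave bs i \<phi> p =
     (\<Sum>j<length bs. sqrt 2 * mixing (length bs) i j * plane_wave (bs ! j) \<phi> p)"

text \<open>The phase 0 gives sums of cosines, the phase \<open>\<pi> / 2\<close> sums of negated sines.\<close>

definition basis_index :: "((int ^ 3) list \<times> nat \<times> real) set" where
  "basis_index = {(bs, i, \<phi>). bs \<in> freq_blocks \<and> i < length bs \<and> \<phi> \<in> {0, pi / 2}}"

text \<open>Plane waves of different positions are orthogonal, so the inner product is that of two rows of the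
  matrix times \<open>cos (\<phi> - \<psi>)\<close>, which vanishes for the two distinct admissible phases.\<close>

lemma block_wave_inner:
  assumes "(bs, i, \<phi>) \<in> basis_index" and "(cs, i', \<psi>) \<in> basis_index"
  shows "(LINT p|torus3_measure. block_wave bs i \<phi> p * block_wave cs i' \<psi> p) =
    (if bs = cs \<and> i = i' \<and> \<phi> = \<psi> then 1 else 0)"
proof -
  have bs: "bs \<in> freq_blocks" "i < length bs" and cs: "cs \<in> freq_blocks" "i' < length cs"
    and phases: "\<phi> \<in> {0, pi / 2}" "\<psi> \<in> {0, pi / 2}"
    using assms by (auto simp: basis_index_def)
  have pair: "(LINT p|torus3_measure. plane_wave (bs ! j) \<phi> p * plane_wave (cs ! j') \<psi> p) =
      (if bs = cs \<and> j = j' then cos (\<phi> - \<psi>) / 2 else 0)"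
    if "j < length bs" "j' < length cs" for j j'
  proof -
    have "bs ! j + cs ! j' \<noteq> 0"
      using freq_blocks_disjoint(1)[OF bs(1) cs(1) that] by (simp add: eq_neg_iff_add_eq_0)
    then show ?thesis
      using freq_blocks_disjoint(2)[OF bs(1) cs(1) that] by (simp add: plane_wave_product_mean)
  qed
  have int: "integrable torus3_measure (\<lambda>p. plane_wave k \<phi> p * plane_wave l \<psi> p)" for k l
    unfolding plane_wave_mult by simp
  have "(LINT p|torus3_measure. block_wave bs i \<phi> p * block_wave cs i' \<psi> p) =
      (LINT p|torus3_measure. (\<Sum>j<length bs. \<Sum>j'<length cs.
        2 * (mixing (length bs) i j * mixing (length cs) i' j') *
          (plane_wave (bs ! j) \<phi> p * plane_wave (cs ! j') \<psi> p)))"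
    unfolding block_wave_def sum_product
    by (intro Bochner_Integration.integral_cong sum.cong) (auto simp: algebra_simps)
  also have "\<dots> = (\<Sum>j<length bs. \<Sum>j'<length cs.
      2 * (mixing (length bs) i j * mixing (length cs) i' j') *
        (LINT p|torus3_measure. plane_wave (bs ! j) \<phi> p * plane_wave (cs ! j') \<psi> p))"
    using int by simp
  also have "\<dots> = (\<Sum>j<length bs. \<Sum>j'<length cs.
      2 * (mixing (length bs) i j * mixing (length cs) i' j') *
        (if bs = cs \<and> j = j' then cos (\<phi> - \<psi>) / 2 else 0))"
    by (intro sum.cong refl arg_cong2[of _ _ _ _ "(*)"] pair) auto
  also have "\<dots> = (if bs = cs \<and> i = i' \<and> \<phi> = \<psi> then 1 else 0)"
  proof (cases "bs = cs")
    case True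
    let ?n = "length bs"
    have "(\<Sum>j<?n. \<Sum>j'<?n. 2 * (mixing ?n i j * mixing ?n i' j') *
        (if bs = cs \<and> j = j' then cos (\<phi> - \<psi>) / 2 else 0)) =
        (\<Sum>j<?n. \<Sum>j'<?n. if j' = j then mixing ?n i j * mixing ?n i' j * cos (\<phi> - \<psi>) else 0)"
      using True by (intro sum.cong) auto
    also have "\<dots> = (\<Sum>j<?n. mixing ?n i j * mixing ?n i' j) * cos (\<phi> - \<psi>)"
      by (simp add: sum_distrib_right)
    also have "\<dots> = (if i = i' then cos (\<phi> - \<psi>) else 0)"
      using mixing_rows[OF length_freq_block[OF bs(1)] bs(2), of i'] cs(2) True by simp
    also have "\<dots> = (if i = i' \<and> \<phi> = \<psi> then 1 else 0)"
      using phases by (elim insertE emptyE; hypsubst; simp)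
    finally show ?thesis using True by simp
  qed simp
  finally show ?thesis .
qed

lemma continuous_block_wave: "continuous_on UNIV (block_wave bs i \<phi>)"
  unfolding block_wave_def by (intro continuous_intros continuous_plane_wave)

text \<open>Only three independent frequencies with a triangle of amplitudes occur in a block wave, so its
  positivity set upstairs is connected; so is that of its negative. The nodal domains are the images
  of these two sets under the projection.\<close>

lemma block_wave_two_nodal_domains:
  assumes "bs \<in> freq_blocks" and "i < length bs"
  shows "card (nodal_domains (\<lambda>p. complex_of_real (block_wave bs i \<phi> p))) = 2"
    and "\<exists>p. block_wave bs i \<phi> p \<noteq> 0"
proof -
  obtain l :: "3 \<Rightarrow> int ^ 3" and a :: "3 \<Rightarrow> real" where
    l: "det (\<chi> m. l m) \<noteq> 0" and dom: "\<And>m. \<bar>a m\<bar> < (\<Sum>j\<in>UNIV - {m}. \<bar>a j\<bar>)"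
    and row: "\<And>h. (\<Sum>j<length bs. mixing (length bs) i j * h (bs ! j)) = (\<Sum>m\<in>UNIV. a m * h (l m))"
    using block_row_three_frequencies[OF assms] by blast
  have lift: "block_wave bs i \<phi> (torus3_proj x) = sqrt 2 * (\<Sum>m\<in>UNIV. a m * cos (angle (l m) x + \<phi>))" for x
    using row[of "\<lambda>k. cos (angle k x + \<phi>)"]
    by (simp add: block_wave_def mult.assoc flip: sum_distrib_left)
  have image: "{p. Q (block_wave bs i \<phi> p)} = torus3_proj ` {x. Q (block_wave bs i \<phi> (torus3_proj x))}" for Q
    by (auto simp: image_iff) (metis proj_rep)
  have pos: "connected {p. 0 < block_wave bs i \<phi> p}" "{p. 0 < block_wave bs i \<phi> p} \<noteq> {}"
    using three_independent_cosines[OF l dom, of \<phi>]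
    unfolding image[of "\<lambda>r. 0 < r"] lift
    by (auto intro!: connected_continuous_image continuous_on_torus3_proj simp: zero_less_mult_iff)
  have "(\<Sum>m\<in>UNIV. a m * cos (angle (l m) x + \<phi>)) < 0 \<longleftrightarrow>
      0 < (\<Sum>m\<in>UNIV. - a m * cos (angle (l m) x + \<phi>))" for x
    by (simp add: sum_negf)
  then have neg: "connected {p. block_wave bs i \<phi> p < 0}" "{p. block_wave bs i \<phi> p < 0} \<noteq> {}"
    using three_independent_cosines[OF l, of "\<lambda>m. - a m" \<phi>] dom
    unfolding image[of "\<lambda>r. r < 0"] lift
    by (auto intro!: connected_continuous_image continuous_on_torus3_proj simp: mult_less_0_iff)
  show "card (nodal_domains (\<lambda>p. complex_of_real (block_wave bs i \<phi> p))) = 2"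
    using continuous_block_wave pos neg by (rule card_nodal_domains_eq_2)
  show "\<exists>p. block_wave bs i \<phi> p \<noteq> 0"
    using pos(2) by (metis (mono_tags, lifting) Collect_empty_eq less_irrefl)
qed

lemma block_wave_eigenfunction:
  assumes "bs \<in> freq_blocks" and "i < length bs"
  shows "laplace_eigenfunction (\<lambda>p. complex_of_real (block_wave bs i \<phi> p))"
  unfolding block_wave_def
  by (rule laplace_eigenfunction_plane_wave_sum[of _ _ "freq_sq (bs ! 0)"])
    (use freq_sq_block[OF assms(1)] block_wave_two_nodal_domains(2)[OF assms] in
      \<open>auto simp: block_wave_def\<close>)

text \<open>Orthogonality of the columns inverts the change of basis within a block.\<close>

lemma plane_wave_from_block_waves:
  assumes "bs \<in> freq_blocks" and "j < length bs"
  shows "plane_wave (bs ! j) \<phi> p =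
    (\<Sum>i<length bs. mixing (length bs) i j / sqrt 2 * block_wave bs i \<phi> p)"
proof -
  let ?n = "length bs"
  have "(\<Sum>i<?n. mixing ?n i j / sqrt 2 * block_wave bs i \<phi> p) =
      (\<Sum>i<?n. \<Sum>j'<?n. mixing ?n i j * mixing ?n i j' * plane_wave (bs ! j') \<phi> p)"
    by (simp add: block_wave_def sum_distrib_left mult.assoc)
  also have "\<dots> = (\<Sum>j'<?n. (\<Sum>i<?n. mixing ?n i j * mixing ?n i j') * plane_wave (bs ! j') \<phi> p)"
    by (subst sum.swap) (simp add: sum_distrib_right)
  also have "\<dots> = (\<Sum>j'<?n. if j' = j then plane_wave (bs ! j) \<phi> p else 0)"
    using assms(2) by (intro sum.cong) (auto simp: mixing_columns[OF length_freq_block[OF assms(1)]])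
  also have "\<dots> = plane_wave (bs ! j) \<phi> p"
    using assms(2) by simp
  finally show ?thesis by simp
qed

definition torus3_basis :: "(torus3 \<Rightarrow> complex) set" where
  "torus3_basis = insert (\<lambda>p. 1)
     ((\<lambda>(bs, i, \<phi>) p. complex_of_real (block_wave bs i \<phi> p)) ` basis_index)"

lemma L2_continuous:
  fixes g :: "torus3 \<Rightarrow> real"
  assumes "continuous_on UNIV g"
  shows "(\<lambda>p. complex_of_real (g p)) \<in> L2_torus3"
proof -
  obtain c where "\<And>p. \<bar>g p\<bar> \<le> c"
    using continuous_torus3_bounded[OF assms] by blast
  then show ?thesis
    using borel_measurable_continuous_onI[OF assms] by (intro L2_bounded[of _ c]) auto
qed

lemma torus3_basis_L2: "torus3_basis \<subseteq> L2_torus3"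
  unfolding torus3_basis_def
  using L2_continuous[OF continuous_block_wave] by (auto intro: L2_bounded[of _ 1])

lemma L2_inner_of_real:
  "L2_inner (\<lambda>p. complex_of_real (f p)) (\<lambda>p. complex_of_real (g p)) =
    of_real (LINT p|torus3_measure. f p * g p)"
  unfolding L2_inner_def by (simp flip: of_real_mult)

text \<open>The basis is a set of functions, while orthogonality is known for indices. Distinct indices belong to
  distinct functions, because their inner product is 0 and not 1.\<close>

lemma torus3_basis_orthonormal:
  assumes "f \<in> torus3_basis" and "g \<in> torus3_basis"
  shows "L2_inner f g = (if f = g then 1 else 0)"
proof -
  let ?w = "\<lambda>(bs, i, \<phi>) p. complex_of_real (block_wave bs i \<phi> p)"
  have one: "L2_inner (\<lambda>p. 1) (\<lambda>p. 1) = 1"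
    using plane_wave_mean[of 0 0] L2_inner_of_real[of "\<lambda>p. 1" "\<lambda>p. 1"] by (simp add: plane_wave_0)
  have mean: "(LINT p|torus3_measure. block_wave bs i \<phi> p) = 0" if "(bs, i, \<phi>) \<in> basis_index" for bs i \<phi>
  proof -
    have "bs ! j \<noteq> 0" if "j < length bs" for j
      using freq_blocks_disjoint(1)[of bs bs j j] that \<open>(bs, i, \<phi>) \<in> basis_index\<close>
      by (auto simp: basis_index_def)
    then show ?thesis
      unfolding block_wave_def by (simp add: Bochner_Integration.integral_sum plane_wave_mean)
  qed
  have one_wave: "L2_inner (\<lambda>p. 1) (?w x) = 0" "L2_inner (?w x) (\<lambda>p. 1) = 0" if "x \<in> basis_index" for x
    using that L2_inner_of_real[of "\<lambda>p. 1"] L2_inner_of_real[of _ "\<lambda>p. 1"] mean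
    by (cases x; simp)+
  have waves: "L2_inner (?w x) (?w y) = (if x = y then 1 else 0)"
    if "x \<in> basis_index" "y \<in> basis_index" for x y
    using that by (cases x; cases y) (simp add: L2_inner_of_real block_wave_inner)
  consider "f = (\<lambda>p. 1)" "g = (\<lambda>p. 1)"
    | y where "f = (\<lambda>p. 1)" "g = ?w y" "y \<in> basis_index"
    | x where "f = ?w x" "g = (\<lambda>p. 1)" "x \<in> basis_index"
    | x y where "f = ?w x" "g = ?w y" "x \<in> basis_index" "y \<in> basis_index"
    using assms unfolding torus3_basis_def by blast
  then show ?thesis
  proof cases
    case 1
    then show ?thesis using one by simp
  next
    case (2 y)
    then have "f \<noteq> g" using one one_wave(1)[of y] by (metis zero_neq_one)
    then show ?thesis using 2 one_wave(1) by simp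
  next
    case (3 x)
    then have "f \<noteq> g" using one one_wave(2)[of x] by (metis zero_neq_one)
    then show ?thesis using 3 one_wave(2) by simp
  next
    case (4 x y)
    then have "f = g \<longleftrightarrow> x = y" using waves[of x x] waves[of x y] by (metis zero_neq_one)
    then show ?thesis using 4 waves by simp
  qed
qed

section \<open>Completeness\<close>

definition finite_combinations :: "(torus3 \<Rightarrow> complex) set \<Rightarrow> (torus3 \<Rightarrow> complex) set" where
  "finite_combinations B = {\<lambda>p. \<Sum>b\<in>F. c b * b p |F c. finite F \<and> F \<subseteq> B}"

lemma finite_combinations_add:
  assumes "f \<in> finite_combinations B" and "g \<in> finite_combinations B"
  shows "(\<lambda>p. f p + g p) \<in> finite_combinations B"
proof -
  obtain F c where F: "finite F" "F \<subseteq> B" "f = (\<lambda>p. \<Sum>b\<in>F. c b * b p)"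
    using assms(1) by (auto simp: finite_combinations_def)
  obtain G d where G: "finite G" "G \<subseteq> B" "g = (\<lambda>p. \<Sum>b\<in>G. d b * b p)"
    using assms(2) by (auto simp: finite_combinations_def)
  let ?c = "\<lambda>b. (if b \<in> F then c b else 0) + (if b \<in> G then d b else 0)"
  have "f p + g p = (\<Sum>b\<in>F \<union> G. ?c b * b p)" for p
  proof -
    have "f p = (\<Sum>b\<in>F \<union> G. (if b \<in> F then c b else 0) * b p)"
      unfolding F(3) using F(1) G(1) by (intro sum.mono_neutral_cong_left) auto
    moreover have "g p = (\<Sum>b\<in>F \<union> G. (if b \<in> G then d b else 0) * b p)"
      unfolding G(3) using F(1) G(1) by (intro sum.mono_neutral_cong_left) auto
    ultimately show ?thesis by (simp only: distrib_right sum.distrib)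
  qed
  then show ?thesis
    unfolding finite_combinations_def using F(1,2) G(1,2)
    by (intro CollectI exI[of _ "F \<union> G"] exI[of _ ?c]) auto
qed

lemma finite_combinations_scale:
  assumes "f \<in> finite_combinations B"
  shows "(\<lambda>p. a * f p) \<in> finite_combinations B"
proof -
  obtain F c where F: "finite F" "F \<subseteq> B" "f = (\<lambda>p. \<Sum>b\<in>F. c b * b p)"
    using assms by (auto simp: finite_combinations_def)
  then have "(\<lambda>p. a * f p) = (\<lambda>p. \<Sum>b\<in>F. (a * c b) * b p)"
    by (simp add: sum_distrib_left mult.assoc)
  then show ?thesis
    unfolding finite_combinations_def using F(1,2)
    by (intro CollectI exI[of _ F] exI[of _ "\<lambda>b. a * c b"]) auto
qed

lemma finite_combinations_base: "b \<in> B \<Longrightarrow> b \<in> finite_combinations B"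
  unfolding finite_combinations_def
  by (intro CollectI exI[of _ "{b}"] exI[of _ "\<lambda>_. 1"]) auto

lemma finite_combinations_sum:
  assumes "finite I" and "\<And>i. i \<in> I \<Longrightarrow> f i \<in> finite_combinations B"
  shows "(\<lambda>p. \<Sum>i\<in>I. c i * f i p) \<in> finite_combinations B"
  using assms
proof (induction I)
  case empty
  show ?case
    unfolding finite_combinations_def by (intro CollectI exI[of _ "{}"]) simp
next
  case (insert i I)
  have "(\<lambda>p. c i * f i p + (\<Sum>i\<in>I. c i * f i p)) \<in> finite_combinations B"
    by (intro finite_combinations_add finite_combinations_scale) (use insert in auto)
  then show ?case by (simp only: sum.insert[OF insert.hyps])
qed

text \<open>The phases 0 and \<open>\<pi> / 2\<close> produce all others by the addition theorem, and reversing the sign of the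
  frequency reverses the sign of the phase.\<close>

lemma plane_wave_in_span:
  "(\<lambda>p. complex_of_real (plane_wave k \<phi> p)) \<in> finite_combinations torus3_basis"
proof (cases "k = 0")
  case True
  have "(\<lambda>p. of_real (cos \<phi>) * 1) \<in> finite_combinations torus3_basis"
    by (intro finite_combinations_scale finite_combinations_base) (simp add: torus3_basis_def)
  then show ?thesis by (simp add: True plane_wave_0)
next
  case False
  obtain bs j where bs: "bs \<in> freq_blocks" "j < length bs" "k = bs ! j \<or> k = - bs ! j"
    using freq_blocks_cover[OF False] by blast
  have quarter: "(\<lambda>p. complex_of_real (plane_wave (bs ! j) \<theta> p)) \<in> finite_combinations torus3_basis"
    if "\<theta> \<in> {0, pi / 2}" for \<theta>
  proof -
    have "(\<lambda>p. \<Sum>i<length bs. of_real (mixing (length bs) i j / sqrt 2) *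
        complex_of_real (block_wave bs i \<theta> p)) \<in> finite_combinations torus3_basis"
    proof (intro finite_combinations_sum finite_combinations_base)
      fix i assume "i \<in> {..<length bs}"
      then have "(bs, i, \<theta>) \<in> basis_index" using bs that by (simp add: basis_index_def)
      then show "(\<lambda>p. complex_of_real (block_wave bs i \<theta> p)) \<in> torus3_basis"
        unfolding torus3_basis_def by (force simp: image_iff)
    qed simp
    then show ?thesis
      unfolding plane_wave_from_block_waves[OF bs(1,2)] by (simp only: of_real_sum of_real_mult)
  qed
  have any: "(\<lambda>p. complex_of_real (plane_wave (bs ! j) \<theta> p)) \<in> finite_combinations torus3_basis" for \<theta>
  proof -
    have "plane_wave (bs ! j) \<theta> p =
        cos \<theta> * plane_wave (bs ! j) 0 p + sin \<theta> * plane_wave (bs ! j) (pi / 2) p" for p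
      by (simp add: plane_wave_def cos_add)
    moreover have "(\<lambda>p. of_real (cos \<theta>) * complex_of_real (plane_wave (bs ! j) 0 p) +
        of_real (sin \<theta>) * complex_of_real (plane_wave (bs ! j) (pi / 2) p)) \<in> finite_combinations torus3_basis"
      by (intro finite_combinations_add finite_combinations_scale quarter) auto
    ultimately show ?thesis by (simp only: of_real_add of_real_mult)
  qed
  have "plane_wave (- l) \<phi> = plane_wave l (- \<phi>)" for l
  proof
    fix p
    have "- angle l (rep_torus3 p) + \<phi> = - (angle l (rep_torus3 p) - \<phi>)" by simp
    then show "plane_wave (- l) \<phi> p = plane_wave l (- \<phi>) p"
      unfolding plane_wave_def angle_uminus by (simp only: cos_minus diff_conv_add_uminus)
  qed
  with any bs(3) show ?thesis by (elim disjE) simp_all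
qed

lemma orthonormal_basis_torus3_basis: "orthonormal_basis_L2 torus3_basis"
proof -
  let ?V = "finite_combinations torus3_basis"
  interpret trig_L2_subspace ?V
  proof
    show "?V \<subseteq> L2_torus3"
    proof
      fix f assume "f \<in> ?V"
      then obtain F c where F: "finite F" "F \<subseteq> torus3_basis" "f = (\<lambda>p. \<Sum>b\<in>F. c b * b p)"
        by (auto simp: finite_combinations_def)
      have "(\<lambda>p. \<Sum>b\<in>F. c b * b p) \<in> L2_torus3"
        using F(1,2)
      proof (induction F)
        case empty
        then show ?case by (simp add: L2_bounded[of _ 0])
      next
        case (insert b F)
        have "(\<lambda>p. c b * b p + (\<Sum>b\<in>F. c b * b p)) \<in> L2_torus3"
          by (intro L2_add L2_scale) (use insert torus3_basis_L2 in auto)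
        then show ?case by (simp only: sum.insert[OF insert.hyps])
      qed
      then show "f \<in> L2_torus3" by (simp only: F(3))
    qed
  qed (auto intro: finite_combinations_add finite_combinations_scale plane_wave_in_span)
  have "\<exists>F c. finite F \<and> F \<subseteq> torus3_basis \<and> L2_dist f (\<lambda>p. \<Sum>b\<in>F. c b * b p) < e"
    if f: "f \<in> L2_torus3" and e: "0 < e" for f e
  proof -
    have "f \<in> L2_closure" using f by (simp add: closure_eq_L2)
    moreover have "0 < e\<^sup>2" using e by simp
    ultimately obtain g where g: "g \<in> ?V" "g \<in> L2_torus3" "sq_dist f g < e\<^sup>2"
      by (rule closureE)
    then obtain F c where F: "finite F" "F \<subseteq> torus3_basis" "g = (\<lambda>p. \<Sum>b\<in>F. c b * b p)"
      by (auto simp: finite_combinations_def)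
    have "L2_dist f g < e"
      using real_sqrt_less_mono[OF g(3)] e by (simp add: L2_dist_def sq_dist_def)
    with F show ?thesis by blast
  qed
  then show ?thesis
    unfolding orthonormal_basis_L2_def
    using torus3_basis_L2 torus3_basis_orthonormal by blast
qed

section \<open>Two nodal domains for every nonconstant basis function\<close>

lemma constant_eigenfunction: "laplace_eigenfunction (\<lambda>p. 1)"
  using laplace_eigenfunction_plane_wave_sum[of "{0::nat}" "\<lambda>_. 0" 0 "\<lambda>_. 1" "\<lambda>_. 0"]
  by (simp add: plane_wave_0 freq_sq_def)

theorem theorem1p11:
  "\<exists>B :: (torus3 \<Rightarrow> complex) set.
     orthonormal_basis_L2 B \<and>
     (\<forall>f\<in>B. (\<forall>p. f p \<in> \<real>) \<and> laplace_eigenfunction f) \<and>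
     (\<forall>f\<in>B. \<not> f constant_on UNIV \<longrightarrow> card (nodal_domains f) = 2)"
proof (intro exI[of _ torus3_basis] conjI ballI allI impI)
  show "orthonormal_basis_L2 torus3_basis" by (rule orthonormal_basis_torus3_basis)
  fix f assume "f \<in> torus3_basis"
  then consider "f = (\<lambda>p. 1)"
    | bs i \<phi> where "bs \<in> freq_blocks" "i < length bs" "f = (\<lambda>p. complex_of_real (block_wave bs i \<phi> p))"
    unfolding torus3_basis_def basis_index_def by auto
  note cases = this
  show "f p \<in> \<real>" for p using cases by cases auto
  show "laplace_eigenfunction f"
    using cases by cases (auto intro: constant_eigenfunction block_wave_eigenfunction)
  show "card (nodal_domains f) = 2" if "\<not> f constant_on UNIV"
    using cases
  proof cases
    case 1
    then show ?thesis using that by (simp add: constant_on_def)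
  next
    case 2
    then show ?thesis by (simp add: block_wave_two_nodal_domains(1))
  qed
qed

end
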